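(* Let $K$ be a field of characteristic $0$, let $L_{\infty}$ be the free Lie algebra over $K$ of countably infinite rank, let $c\geq 1$ be an integer, and let $L_{\infty,c}=L_{\infty}/\gamma_{c+1}(L_{\infty})$ be the free nilpotent Lie algebra of countably infinite rank and class $c$. Then every automorphism of $L_{\infty,c}$ lifts to an automorphism of $L_{\infty}$; that is, for every $\alpha\in\operatorname{Aut}(L_{\infty,c})$ there exists $\phi\in\operatorname{Aut}(L_{\infty})$ such that $\pi\circ\phi=\alpha\circ\pi$, where $\pi\colon L_{\infty}\to L_{\infty,c}$ is the natural projection.
   Context: All Lie algebras are over $K$, and automorphisms are $K$-linear Lie algebra automorphisms. $\gamma_i(M)$ denotes the $i$-th term of the lower central series of a Lie algebra $M$ ($\gamma_1(M)=M$, $\gamma_{i+1}(M)=[\gamma_i(M),M]$). $L_{\infty}$ is freely generated by a countably infinite set $\{\ell_i : i\in\mathbb{N}\}$, with $\mathbb{N}$ the positive integers. *)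

theory Defs
  imports "HOL-Algebra.Group"
begin

record ('k, 'a) lie_structure = "'a partial_object" +
  lie_add :: "'a \<Rightarrow> 'a \<Rightarrow> 'a"
  lie_zero :: 'a
  lie_scale :: "'k \<Rightarrow> 'a \<Rightarrow> 'a"
  lie_bracket :: "'a \<Rightarrow> 'a \<Rightarrow> 'a"

locale lie_algebra =
  fixes L :: "('k::field, 'a) lie_structure"
  assumes additive_group:
      "comm_group \<lparr>carrier = carrier L, monoid.mult = lie_add L, one = lie_zero L\<rparr>"
    and scale_closed: "x \<in> carrier L \<Longrightarrow> lie_scale L a x \<in> carrier L"
    and scale_add_right: "\<lbrakk>x \<in> carrier L; y \<in> carrier L\<rbrakk> \<Longrightarrow>
      lie_scale L a (lie_add L x y) = lie_add L (lie_scale L a x) (lie_scale L a y)"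
    and scale_add_left: "x \<in> carrier L \<Longrightarrow>
      lie_scale L (a + b) x = lie_add L (lie_scale L a x) (lie_scale L b x)"
    and scale_scale: "x \<in> carrier L \<Longrightarrow> lie_scale L a (lie_scale L b x) = lie_scale L (a * b) x"
    and scale_one: "x \<in> carrier L \<Longrightarrow> lie_scale L 1 x = x"
    and bracket_closed: "\<lbrakk>x \<in> carrier L; y \<in> carrier L\<rbrakk> \<Longrightarrow> lie_bracket L x y \<in> carrier L"
    and bracket_add_left: "\<lbrakk>x \<in> carrier L; y \<in> carrier L; z \<in> carrier L\<rbrakk> \<Longrightarrow>
      lie_bracket L (lie_add L x y) z = lie_add L (lie_bracket L x z) (lie_bracket L y z)"
    and bracket_add_right: "\<lbrakk>x \<in> carrier L; y \<in> carrier L; z \<in> carrier L\<rbrakk> \<Longrightarrow>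
      lie_bracket L x (lie_add L y z) = lie_add L (lie_bracket L x y) (lie_bracket L x z)"
    and bracket_scale_left: "\<lbrakk>x \<in> carrier L; y \<in> carrier L\<rbrakk> \<Longrightarrow>
      lie_bracket L (lie_scale L a x) y = lie_scale L a (lie_bracket L x y)"
    and bracket_scale_right: "\<lbrakk>x \<in> carrier L; y \<in> carrier L\<rbrakk> \<Longrightarrow>
      lie_bracket L x (lie_scale L a y) = lie_scale L a (lie_bracket L x y)"
    and bracket_self: "x \<in> carrier L \<Longrightarrow> lie_bracket L x x = lie_zero L"
    and jacobi: "\<lbrakk>x \<in> carrier L; y \<in> carrier L; z \<in> carrier L\<rbrakk> \<Longrightarrow>
      lie_add L (lie_add L (lie_bracket L x (lie_bracket L y z)) (lie_bracket L y (lie_bracket L z x)))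
        (lie_bracket L z (lie_bracket L x y)) = lie_zero L"

definition lie_hom ::
  "('k, 'a) lie_structure \<Rightarrow> ('k, 'b) lie_structure \<Rightarrow> ('a \<Rightarrow> 'b) set" where
  "lie_hom L M = {f \<in> carrier L \<rightarrow> carrier M.
     (\<forall>x\<in>carrier L. \<forall>y\<in>carrier L. f (lie_add L x y) = lie_add M (f x) (f y)) \<and>
     (\<forall>a. \<forall>x\<in>carrier L. f (lie_scale L a x) = lie_scale M a (f x)) \<and>
     (\<forall>x\<in>carrier L. \<forall>y\<in>carrier L. f (lie_bracket L x y) = lie_bracket M (f x) (f y))}"

text \<open>Values of a homomorphism outside the carrier are left unconstrained.\<close>

definition lie_aut :: "('k, 'a) lie_structure \<Rightarrow> ('a \<Rightarrow> 'a) set" where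
  "lie_aut L = {f \<in> lie_hom L L. bij_betw f (carrier L) (carrier L)}"

definition lie_subspace :: "('k, 'a) lie_structure \<Rightarrow> 'a set \<Rightarrow> bool" where
  "lie_subspace L V \<longleftrightarrow> V \<subseteq> carrier L \<and> lie_zero L \<in> V \<and>
     (\<forall>x\<in>V. \<forall>y\<in>V. lie_add L x y \<in> V) \<and> (\<forall>a. \<forall>x\<in>V. lie_scale L a x \<in> V)"

definition lie_span :: "('k, 'a) lie_structure \<Rightarrow> 'a set \<Rightarrow> 'a set" where
  "lie_span L S = \<Inter>{V. lie_subspace L V \<and> S \<subseteq> V}"

definition lie_ideal :: "('k, 'a) lie_structure \<Rightarrow> 'a set \<Rightarrow> bool" where
  "lie_ideal L I \<longleftrightarrow> lie_subspace L I \<and>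
     (\<forall>x\<in>I. \<forall>y\<in>carrier L. lie_bracket L x y \<in> I \<and> lie_bracket L y x \<in> I)"

text \<open>The series is indexed from 1; the value at index 0 is a dummy.\<close>

fun lower_central :: "('k, 'a) lie_structure \<Rightarrow> nat \<Rightarrow> 'a set" where
  "lower_central L 0 = carrier L"
| "lower_central L (Suc 0) = carrier L"
| "lower_central L (Suc (Suc i)) =
     lie_span L {lie_bracket L x y | x y. x \<in> lower_central L (Suc i) \<and> y \<in> carrier L}"

definition lie_coset :: "('k, 'a) lie_structure \<Rightarrow> 'a set \<Rightarrow> 'a \<Rightarrow> 'a set" where
  "lie_coset L I x = lie_add L x ` I"

text \<open>Elements of the quotient are cosets. Each operation is the union of the cosets of the results
  on representatives, which for an ideal is a single coset.\<close>

definition lie_quotient :: "('k, 'a) lie_structure \<Rightarrow> 'a set \<Rightarrow> ('k, 'a set) lie_structure" where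
  "lie_quotient L I =
    \<lparr>carrier = lie_coset L I ` carrier L,
     lie_add = (\<lambda>X Y. \<Union>x\<in>X. \<Union>y\<in>Y. lie_coset L I (lie_add L x y)),
     lie_zero = I,
     lie_scale = (\<lambda>a X. \<Union>x\<in>X. lie_coset L I (lie_scale L a x)),
     lie_bracket = (\<lambda>X Y. \<Union>x\<in>X. \<Union>y\<in>Y. lie_coset L I (lie_bracket L x y))\<rparr>"

text \<open>The free Lie algebra on a set of generators is the term algebra modulo the congruence generated
  by the Lie algebra axioms; its universal property is \<open>free_lie_universal\<close> below.\<close>

datatype ('k, 'x) lie_term =
    Gen 'x
  | Zero
  | Add "('k, 'x) lie_term" "('k, 'x) lie_term"
  | Scale 'k "('k, 'x) lie_term"
  | Bracket "('k, 'x) lie_term" "('k, 'x) lie_term"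

inductive lie_eq :: "('k::field, 'x) lie_term \<Rightarrow> ('k, 'x) lie_term \<Rightarrow> bool" where
  refl: "lie_eq s s"
| sym: "lie_eq s t \<Longrightarrow> lie_eq t s"
| trans: "lie_eq s t \<Longrightarrow> lie_eq t u \<Longrightarrow> lie_eq s u"
| cong_Add: "lie_eq s s' \<Longrightarrow> lie_eq t t' \<Longrightarrow> lie_eq (Add s t) (Add s' t')"
| cong_Scale: "lie_eq s s' \<Longrightarrow> lie_eq (Scale a s) (Scale a s')"
| cong_Bracket: "lie_eq s s' \<Longrightarrow> lie_eq t t' \<Longrightarrow> lie_eq (Bracket s t) (Bracket s' t')"
| add_assoc: "lie_eq (Add (Add s t) u) (Add s (Add t u))"
| add_comm: "lie_eq (Add s t) (Add t s)"
| add_zero: "lie_eq (Add Zero s) s"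
| add_inverse: "lie_eq (Add (Scale (-1) s) s) Zero"
| scale_add_right: "lie_eq (Scale a (Add s t)) (Add (Scale a s) (Scale a t))"
| scale_add_left: "lie_eq (Scale (a + b) s) (Add (Scale a s) (Scale b s))"
| scale_scale: "lie_eq (Scale a (Scale b s)) (Scale (a * b) s)"
| scale_one: "lie_eq (Scale 1 s) s"
| bracket_add_left: "lie_eq (Bracket (Add s t) u) (Add (Bracket s u) (Bracket t u))"
| bracket_add_right: "lie_eq (Bracket s (Add t u)) (Add (Bracket s t) (Bracket s u))"
| bracket_scale_left: "lie_eq (Bracket (Scale a s) t) (Scale a (Bracket s t))"
| bracket_scale_right: "lie_eq (Bracket s (Scale a t)) (Scale a (Bracket s t))"
| bracket_self: "lie_eq (Bracket s s) Zero"
| jacobi: "lie_eq (Add (Add (Bracket s (Bracket t u)) (Bracket t (Bracket u s)))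
    (Bracket u (Bracket s t))) Zero"

quotient_type (overloaded) ('k, 'x) free_lie = "('k::field, 'x) lie_term" / lie_eq
  by (auto intro!: equivpI reflpI sympI transpI intro: lie_eq.refl lie_eq.sym lie_eq.trans)

lift_definition free_gen :: "'x \<Rightarrow> ('k::field, 'x) free_lie" is Gen .

lift_definition free_zero :: "('k::field, 'x) free_lie" is Zero .

lift_definition free_add ::
  "('k::field, 'x) free_lie \<Rightarrow> ('k, 'x) free_lie \<Rightarrow> ('k, 'x) free_lie" is Add
  by (rule lie_eq.cong_Add)

lift_definition free_scale :: "'k \<Rightarrow> ('k::field, 'x) free_lie \<Rightarrow> ('k, 'x) free_lie" is Scale
  by (rule lie_eq.cong_Scale)

lift_definition free_bracket ::
  "('k::field, 'x) free_lie \<Rightarrow> ('k, 'x) free_lie \<Rightarrow> ('k, 'x) free_lie" is Bracket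
  by (rule lie_eq.cong_Bracket)

definition free_lie_algebra :: "('k::field, ('k, 'x) free_lie) lie_structure" where
  "free_lie_algebra =
    \<lparr>carrier = UNIV, lie_add = free_add, lie_zero = free_zero,
     lie_scale = free_scale, lie_bracket = free_bracket\<rparr>"

lemma lie_algebra_free_lie_algebra:
  "lie_algebra (free_lie_algebra :: ('k::field, ('k, 'x) free_lie) lie_structure)"
proof (unfold_locales, simp_all add: free_lie_algebra_def Units_def)
  show "free_add (free_add x y) z = free_add x (free_add y z)" for x y z :: "('k, 'x) free_lie"
    by transfer (rule lie_eq.add_assoc)
  show zl: "free_add free_zero x = x" for x :: "('k, 'x) free_lie"
    by transfer (rule lie_eq.add_zero)
  show cm: "free_add x y = free_add y x" for x y :: "('k, 'x) free_lie"
    by transfer (rule lie_eq.add_comm)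
  show "free_add x free_zero = x" for x :: "('k, 'x) free_lie"
    using zl cm by metis
  have inv: "free_add (free_scale (-1) x) x = free_zero" for x :: "('k, 'x) free_lie"
    by transfer (rule lie_eq.add_inverse)
  show "UNIV \<subseteq> {y :: ('k, 'x) free_lie. \<exists>x. free_add x y = free_zero \<and> free_add y x = free_zero}"
    using inv cm by (metis (mono_tags, lifting) mem_Collect_eq subsetI)
next
  fix x y z :: "('k, 'x) free_lie" and a b :: 'k
  show "free_scale a (free_add x y) = free_add (free_scale a x) (free_scale a y)"
    by transfer (rule lie_eq.scale_add_right)
  show "free_scale (a + b) x = free_add (free_scale a x) (free_scale b x)"
    by transfer (rule lie_eq.scale_add_left)
  show "free_scale a (free_scale b x) = free_scale (a * b) x"
    by transfer (rule lie_eq.scale_scale)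
  show "free_scale 1 x = x"
    by transfer (rule lie_eq.scale_one)
  show "free_bracket (free_add x y) z = free_add (free_bracket x z) (free_bracket y z)"
    by transfer (rule lie_eq.bracket_add_left)
  show "free_bracket x (free_add y z) = free_add (free_bracket x y) (free_bracket x z)"
    by transfer (rule lie_eq.bracket_add_right)
  show "free_bracket (free_scale a x) y = free_scale a (free_bracket x y)"
    by transfer (rule lie_eq.bracket_scale_left)
  show "free_bracket x (free_scale a y) = free_scale a (free_bracket x y)"
    by transfer (rule lie_eq.bracket_scale_right)
  show "free_bracket x x = free_zero"
    by transfer (rule lie_eq.bracket_self)
  show "free_add (free_add (free_bracket x (free_bracket y z)) (free_bracket y (free_bracket z x)))
      (free_bracket z (free_bracket x y)) = free_zero"
    by transfer (rule lie_eq.jacobi)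
qed

context lie_algebra
begin

lemma add_closed: "x \<in> carrier L \<Longrightarrow> y \<in> carrier L \<Longrightarrow> lie_add L x y \<in> carrier L"
  using monoid.m_closed[OF group.is_monoid[OF comm_group.axioms(2)[OF additive_group]], of x y] by simp

lemma zero_closed: "lie_zero L \<in> carrier L"
  using monoid.one_closed[OF group.is_monoid[OF comm_group.axioms(2)[OF additive_group]]] by simp

lemma add_assoc: "\<lbrakk>x \<in> carrier L; y \<in> carrier L; z \<in> carrier L\<rbrakk> \<Longrightarrow>
    lie_add L (lie_add L x y) z = lie_add L x (lie_add L y z)"
  using monoid.m_assoc[OF group.is_monoid[OF comm_group.axioms(2)[OF additive_group]], of x y z] by simp

lemma add_comm: "\<lbrakk>x \<in> carrier L; y \<in> carrier L\<rbrakk> \<Longrightarrow> lie_add L x y = lie_add L y x"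
  using comm_monoid.m_comm[OF comm_group.axioms(1)[OF additive_group], of x y] by simp

lemma zero_add: "x \<in> carrier L \<Longrightarrow> lie_add L (lie_zero L) x = x"
  using monoid.l_one[OF group.is_monoid[OF comm_group.axioms(2)[OF additive_group]], of x] by simp

lemma zero_scale:
  assumes x: "x \<in> carrier L"
  shows "lie_scale L 0 x = lie_zero L"
proof -
  have "lie_add L x (lie_scale L 0 x) = x"
    using scale_add_left[OF x, of 1 0] by (simp add: scale_one x)
  then show ?thesis
    using group.l_cancel_one[OF comm_group.axioms(2)[OF additive_group], of x "lie_scale L 0 x"] x
    by (simp add: scale_closed)
qed

lemma neg_add: "x \<in> carrier L \<Longrightarrow> lie_add L (lie_scale L (-1) x) x = lie_zero L"
  using scale_add_left[of x "-1" 1] by (simp add: scale_one zero_scale)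

primrec eval_term :: "('x \<Rightarrow> 'a) \<Rightarrow> ('k, 'x) lie_term \<Rightarrow> 'a" where
  "eval_term f (Gen x) = f x"
| "eval_term f Zero = lie_zero L"
| "eval_term f (Add s t) = lie_add L (eval_term f s) (eval_term f t)"
| "eval_term f (Scale a s) = lie_scale L a (eval_term f s)"
| "eval_term f (Bracket s t) = lie_bracket L (eval_term f s) (eval_term f t)"

lemma eval_term_closed: "range f \<subseteq> carrier L \<Longrightarrow> eval_term f t \<in> carrier L"
  by (induction t) (auto simp: add_closed zero_closed scale_closed bracket_closed)

lemma eval_term_cong: "lie_eq s t \<Longrightarrow> range f \<subseteq> carrier L \<Longrightarrow> eval_term f s = eval_term f t"
proof (induction rule: lie_eq.induct)
  case (add_comm s t)
  show ?case
    using lie_algebra.add_comm[OF lie_algebra_axioms, of "eval_term f s" "eval_term f t"] add_comm by (simp add: eval_term_closed)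
next
  case (jacobi s t u)
  then show ?case
    using lie_algebra.jacobi[OF lie_algebra_axioms, of "eval_term f s" "eval_term f t" "eval_term f u"]
    by (simp add: eval_term_closed)
qed (simp_all add: eval_term_closed add_closed zero_closed scale_closed bracket_closed add_assoc
      zero_add neg_add scale_add_right scale_add_left scale_scale scale_one bracket_add_left
      bracket_add_right bracket_scale_left bracket_scale_right bracket_self)

theorem free_lie_universal:
  fixes f :: "'x \<Rightarrow> 'a"
  assumes f: "range f \<subseteq> carrier L"
  shows "\<exists>!h. h \<in> lie_hom free_lie_algebra L \<and> (\<forall>x. h (free_gen x) = f x)"
proof (rule ex_ex1I)
  have rep: "eval_term f (rep_free_lie (abs_free_lie t)) = eval_term f t" for t :: "('k, 'x) lie_term"
    by (rule eval_term_cong[OF _ f])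
      (metis Quotient3_free_lie Quotient3_rep_abs lie_eq.refl)
  define h :: "('k, 'x) free_lie \<Rightarrow> 'a" where "h = (\<lambda>X. eval_term f (rep_free_lie X))"
  have h: "h (abs_free_lie t) = eval_term f t" for t
    by (simp add: h_def rep)
  have gen: "h (free_gen x) = f x" for x
    by (simp add: free_gen.abs_eq h)
  have add: "h (free_add X Y) = lie_add L (h X) (h Y)" for X Y
    by (induction X rule: free_lie.abs_induct, induction Y rule: free_lie.abs_induct)
      (simp add: free_add.abs_eq h)
  have scale: "h (free_scale a X) = lie_scale L a (h X)" for a X
    by (induction X rule: free_lie.abs_induct) (simp add: free_scale.abs_eq h)
  have bracket: "h (free_bracket X Y) = lie_bracket L (h X) (h Y)" for X Y
    by (induction X rule: free_lie.abs_induct, induction Y rule: free_lie.abs_induct)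
      (simp add: free_bracket.abs_eq h)
  have "h X \<in> carrier L" for X
    by (simp add: h_def eval_term_closed[OF f])
  then show "\<exists>h. h \<in> lie_hom free_lie_algebra L \<and> (\<forall>x. h (free_gen x) = f x)"
    using gen add scale bracket
    by (intro exI[of _ h]) (auto simp: lie_hom_def free_lie_algebra_def)
next
  fix g h :: "('k, 'x) free_lie \<Rightarrow> 'a"
  have eval: "g (abs_free_lie t) = eval_term f t"
    if g: "g \<in> lie_hom free_lie_algebra L \<and> (\<forall>x. g (free_gen x) = f x)"
    for g :: "('k, 'x) free_lie \<Rightarrow> 'a" and t
  proof -
    have cl: "g X \<in> carrier L" and sc: "g (free_scale a X) = lie_scale L a (g X)" for a X
      using g by (auto simp: lie_hom_def free_lie_algebra_def)
    have "g free_zero = lie_zero L"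
      using sc[of 0 free_zero] cl[of free_zero]
        lie_algebra.zero_scale[OF lie_algebra_free_lie_algebra,
          of "free_zero :: ('k, 'x) free_lie"]
        zero_scale[of "g free_zero"]
      by (simp add: free_lie_algebra_def)
    then show ?thesis
      using g
      by (induction t)
        (auto simp: lie_hom_def free_lie_algebra_def simp flip: free_gen.abs_eq free_zero.abs_eq
          free_add.abs_eq free_scale.abs_eq free_bracket.abs_eq)
  qed
  assume g: "g \<in> lie_hom free_lie_algebra L \<and> (\<forall>x. g (free_gen x) = f x)"
    and h: "h \<in> lie_hom free_lie_algebra L \<and> (\<forall>x. h (free_gen x) = f x)"
  show "g = h"
  proof
    show "g X = h X" for X
      by (induction X rule: free_lie.abs_induct) (simp add: eval[OF g] eval[OF h])
  qed
qed

lemma bracket_swap: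
  assumes x: "x \<in> carrier L" and y: "y \<in> carrier L"
  shows "lie_bracket L y x = lie_scale L (-1) (lie_bracket L x y)"
proof -
  let ?p = "lie_bracket L x y" and ?q = "lie_bracket L y x"
  have p: "?p \<in> carrier L" and q: "?q \<in> carrier L" and xy: "lie_add L x y \<in> carrier L"
    using x y by (auto simp: bracket_closed add_closed)
  have "lie_add L ?p ?q = lie_bracket L (lie_add L x y) (lie_add L x y)"
    using x y p q xy
    by (simp add: bracket_add_left bracket_add_right bracket_self[OF x] bracket_self[OF y] zero_add
        add_comm[of _ "lie_zero L"] add_comm[of ?q ?p] zero_closed add_closed del: bracket_self)
  then have pq: "lie_add L ?p ?q = lie_zero L"
    by (simp add: bracket_self[OF xy])
  have "?q = lie_add L (lie_add L (lie_scale L (-1) ?p) ?p) ?q"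
    using p q by (simp add: neg_add zero_add)
  also have "\<dots> = lie_scale L (-1) ?p"
    using p q pq
    by (simp add: add_assoc scale_closed add_comm[of _ "lie_zero L"] zero_closed zero_add)
  finally show ?thesis .
qed

lemma lie_subspace_span:
  assumes "S \<subseteq> carrier L"
  shows "lie_subspace L (lie_span L S)"
proof -
  have "lie_subspace L (carrier L)"
    by (simp add: lie_subspace_def add_closed zero_closed scale_closed)
  then have "lie_span L S \<subseteq> carrier L"
    using assms by (auto simp: lie_span_def)
  then show ?thesis
    by (auto simp: lie_subspace_def lie_span_def)
qed

lemma lie_span_superset: "S \<subseteq> lie_span L S"
  by (auto simp: lie_span_def)

lemma lie_span_minimal: "lie_subspace L V \<Longrightarrow> S \<subseteq> V \<Longrightarrow> lie_span L S \<subseteq> V"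
  by (auto simp: lie_span_def)

lemma lie_ideal_lower_central: "lie_ideal L (lower_central L i)"
proof (induction i rule: nat_induct)
  case 0
  show ?case
    by (simp add: lie_ideal_def lie_subspace_def add_closed zero_closed scale_closed bracket_closed)
next
  case (Suc i)
  show ?case
  proof (cases i)
    case 0
    then show ?thesis
      using Suc by simp
  next
    case (Suc j)
    let ?V = "lower_central L (Suc j)"
    let ?S = "{lie_bracket L x y | x y. x \<in> ?V \<and> y \<in> carrier L}"
    have V: "lie_ideal L ?V"
      using Suc.IH Suc by simp
    then have Vc: "?V \<subseteq> carrier L" and SV: "?S \<subseteq> ?V"
      by (auto simp: lie_ideal_def lie_subspace_def)
    have sub: "lie_subspace L (lie_span L ?S)"
      using SV Vc by (intro lie_subspace_span) blast
    have spV: "lie_span L ?S \<subseteq> ?V"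
      using V SV by (intro lie_span_minimal) (auto simp: lie_ideal_def)
    have "lie_bracket L x y \<in> lie_span L ?S \<and> lie_bracket L y x \<in> lie_span L ?S"
      if x: "x \<in> lie_span L ?S" and y: "y \<in> carrier L" for x y
    proof -
      have xV: "x \<in> ?V"
        using x spV by blast
      have *: "lie_bracket L x y \<in> lie_span L ?S"
        using xV y lie_span_superset[of ?S] by blast
      then have "lie_scale L (-1) (lie_bracket L x y) \<in> lie_span L ?S"
        using sub by (auto simp: lie_subspace_def)
      then show ?thesis
        using * bracket_swap[of x y] xV Vc y by auto
    qed
    then show ?thesis
      using sub Suc by (simp add: lie_ideal_def)
  qed
qed

context
  fixes I :: "'a set"
  assumes I: "lie_ideal L I"
begin

lemma ideal_closed:
  shows "i \<in> I \<Longrightarrow> i \<in> carrier L"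
    and "lie_zero L \<in> I"
    and "i \<in> I \<Longrightarrow> j \<in> I \<Longrightarrow> lie_add L i j \<in> I"
    and "i \<in> I \<Longrightarrow> lie_scale L a i \<in> I"
    and "i \<in> I \<Longrightarrow> x \<in> carrier L \<Longrightarrow> lie_bracket L i x \<in> I"
    and "i \<in> I \<Longrightarrow> x \<in> carrier L \<Longrightarrow> lie_bracket L x i \<in> I"
  using I by (auto simp: lie_ideal_def lie_subspace_def)

lemma coset_absorb:
  assumes x: "x \<in> carrier L" and i: "i \<in> I"
  shows "lie_coset L I (lie_add L x i) = lie_coset L I x"
proof -
  have "\<exists>k\<in>I. lie_add L x j = lie_add L (lie_add L x i) k" if j: "j \<in> I" for j
  proof
    show "lie_add L (lie_scale L (-1) i) j \<in> I"
      using i j by (simp add: ideal_closed)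
    have "lie_add L (lie_add L x i) (lie_add L (lie_scale L (-1) i) j) =
        lie_add L x (lie_add L (lie_add L (lie_scale L (-1) i) i) j)"
      using x i j
      by (simp add: ideal_closed add_assoc add_closed scale_closed add_comm[of i "lie_scale L (-1) i"]
          flip: add_assoc[of i "lie_scale L (-1) i" j])
    then show "lie_add L x j = lie_add L (lie_add L x i) (lie_add L (lie_scale L (-1) i) j)"
      using i j by (simp add: neg_add zero_add ideal_closed)
  qed
  then show ?thesis
    using x i by (auto simp: lie_coset_def image_iff add_assoc ideal_closed)
qed

lemma coset_self: "x \<in> carrier L \<Longrightarrow> x \<in> lie_coset L I x"
  using ideal_closed(2)
  by (auto simp: lie_coset_def image_iff zero_add add_comm[of x "lie_zero L"] zero_closed
      intro!: bexI[of _ "lie_zero L"])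

lemma coset_zero: "lie_coset L I (lie_zero L) = I"
  by (auto simp: lie_coset_def image_iff zero_add ideal_closed)

lemma quotient_add:
  assumes x: "x \<in> carrier L" and y: "y \<in> carrier L"
  shows "lie_add (lie_quotient L I) (lie_coset L I x) (lie_coset L I y) =
    lie_coset L I (lie_add L x y)"
proof -
  have "lie_coset L I (lie_add L (lie_add L x i) (lie_add L y j)) = lie_coset L I (lie_add L x y)"
    if i: "i \<in> I" and j: "j \<in> I" for i j
  proof -
    have "lie_add L (lie_add L x i) (lie_add L y j) = lie_add L (lie_add L x y) (lie_add L i j)"
      using x y i j
      by (simp add: add_assoc add_closed ideal_closed)
        (simp add: add_comm[of i y] add_closed ideal_closed flip: add_assoc)
    then show ?thesis
      using x y i j by (simp add: coset_absorb add_closed ideal_closed)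
  qed
  then show ?thesis
    using coset_self[OF x] coset_self[OF y] by (auto simp: lie_quotient_def lie_coset_def)
qed

lemma quotient_scale:
  assumes x: "x \<in> carrier L"
  shows "lie_scale (lie_quotient L I) a (lie_coset L I x) = lie_coset L I (lie_scale L a x)"
proof -
  have "lie_coset L I (lie_scale L a (lie_add L x i)) = lie_coset L I (lie_scale L a x)"
    if i: "i \<in> I" for i
    using x i by (simp add: scale_add_right coset_absorb scale_closed ideal_closed)
  then show ?thesis
    using coset_self[OF x] by (auto simp: lie_quotient_def lie_coset_def)
qed

lemma quotient_bracket:
  assumes x: "x \<in> carrier L" and y: "y \<in> carrier L"
  shows "lie_bracket (lie_quotient L I) (lie_coset L I x) (lie_coset L I y) =
    lie_coset L I (lie_bracket L x y)"
proof -
  have "lie_coset L I (lie_bracket L (lie_add L x i) (lie_add L y j)) = lie_coset L I (lie_bracket L x y)"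
    if i: "i \<in> I" and j: "j \<in> I" for i j
    using x y i j
    by (simp add: bracket_add_left bracket_add_right coset_absorb add_closed bracket_closed ideal_closed)
  then show ?thesis
    using coset_self[OF x] coset_self[OF y] by (auto simp: lie_quotient_def lie_coset_def)
qed

lemma carrier_quotient: "carrier (lie_quotient L I) = lie_coset L I ` carrier L"
  by (simp add: lie_quotient_def)

lemma quotient_zero: "lie_zero (lie_quotient L I) = lie_coset L I (lie_zero L)"
  by (simp add: lie_quotient_def coset_zero)

lemma lie_hom_coset: "lie_coset L I \<in> lie_hom L (lie_quotient L I)"
  by (auto simp: lie_hom_def carrier_quotient quotient_add quotient_scale quotient_bracket)

lemma lie_algebra_quotient: "lie_algebra (lie_quotient L I)"
proof (intro lie_algebra.intro)
  let ?A = "\<lparr>carrier = carrier (lie_quotient L I), monoid.mult = lie_add (lie_quotient L I),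
    one = lie_zero (lie_quotient L I)\<rparr>"
  show "comm_group ?A"
  proof (rule comm_groupI)
    show "X \<otimes>\<^bsub>?A\<^esub> Y = Y \<otimes>\<^bsub>?A\<^esub> X" if "X \<in> carrier ?A" "Y \<in> carrier ?A" for X Y
      using that by (auto simp: carrier_quotient quotient_add add_comm)
  next
    show "\<exists>Y\<in>carrier ?A. Y \<otimes>\<^bsub>?A\<^esub> X = \<one>\<^bsub>?A\<^esub>" if X_in: "X \<in> carrier ?A" for X
    proof -
      obtain x where x: "x \<in> carrier L" and X: "X = lie_coset L I x"
        using X_in by (auto simp: carrier_quotient)
      then show ?thesis
        by (auto simp: carrier_quotient quotient_add quotient_zero scale_closed neg_add
            intro!: bexI[of _ "lie_scale L (-1) x"])
    qed
  qed (auto simp: carrier_quotient quotient_add quotient_zero add_closed zero_closed add_assoc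
      zero_add)
qed (auto simp: carrier_quotient quotient_add quotient_scale quotient_bracket quotient_zero
    add_closed zero_closed scale_closed bracket_closed scale_add_right scale_add_left scale_scale
    scale_one bracket_add_left bracket_add_right bracket_scale_left bracket_scale_right
    bracket_self jacobi)

end

end

definition L_inf :: "('k::field, ('k, nat) free_lie) lie_structure" where
  "L_inf = free_lie_algebra"

definition L_inf_nilpotent :: "nat \<Rightarrow> ('k::field, ('k, nat) free_lie set) lie_structure" where
  "L_inf_nilpotent c = lie_quotient L_inf (lower_central L_inf (c + 1))"

definition L_inf_proj :: "nat \<Rightarrow> ('k::field, nat) free_lie \<Rightarrow> ('k, nat) free_lie set" where
  "L_inf_proj c = lie_coset L_inf (lower_central L_inf (c + 1))"

end

theory Submission
  imports Defs Complex_Main "HOL-Library.Function_Algebras"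
begin

text \<open>Write \<open>L\<close> for the free Lie algebra on \<open>x\<^sub>0, x\<^sub>1, \<dots>\<close> and \<open>\<gamma>\<^sub>n\<close> for the terms of its lower central
series. An automorphism of the quotient, and its inverse, come from endomorphisms \<open>a\<close>, \<open>b\<close> of \<open>L\<close>
that are inverse to each other modulo \<open>\<gamma>\<^sub>c\<^sub>+\<^sub>1\<close>, so \<open>a\<close> has to be approximated modulo \<open>\<gamma>\<^sub>c\<^sub>+\<^sub>1\<close> by an
automorphism of \<open>L\<close>. Modulo \<open>\<gamma>\<^sub>2\<close> the linear part of \<open>a\<close> does this (\<open>lift_mod_derived\<close>). If \<open>\<phi>\<close>
agrees with \<open>a\<close> modulo \<open>\<gamma>\<^sub>c\<close>, then \<open>\<phi>\<inverse> a\<close> shifts each \<open>x\<^sub>i\<close> by some \<open>d\<^sub>i \<in> \<gamma>\<^sub>c\<close>, and by induction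
everything reduces to one claim (\<open>every_shift_realised\<close>): for \<open>c \<ge> 2\<close> and every family
\<open>(d\<^sub>i)\<close> in \<open>\<gamma>\<^sub>c\<close> there is an automorphism with \<open>x\<^sub>i \<mapsto> x\<^sub>i + d\<^sub>i\<close> modulo \<open>\<gamma>\<^sub>c\<^sub>+\<^sub>1\<close>. Composing such
automorphisms adds their shifts modulo \<open>\<gamma>\<^sub>c\<^sub>+\<^sub>1\<close>, so the realisable families may be superposed.

The basic realisable families are \<open>d\<^sub>i = w(x\<^sub>i) u\<close> with a linear form \<open>w\<close> and an element \<open>u\<close> of the
subalgebra generated by \<open>ker w\<close>: the map \<open>x\<^sub>i \<mapsto> x\<^sub>i + w(x\<^sub>i) u\<close> fixes \<open>u\<close>, so changing the sign of \<open>u\<close>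
gives its inverse. In finite rank these do not produce every family, since they are
annihilated by trace forms. In infinite rank the obstruction can be pushed to infinity. Given a shift
\<open>u\<close> at \<open>x = x\<^sub>i\<close>, take a generator \<open>y\<close> that does not occur in \<open>u\<close>, and let \<open>\<theta>\<^sub>s\<close> send \<open>x\<close> to \<open>x + s y\<close>.
The shift by \<open>s \<theta>\<^sub>s(u)\<close> at \<open>x\<close> and \<open>- \<theta>\<^sub>s(u)\<close> at \<open>y\<close> is basic for every scalar \<open>s\<close>, hence so, up to linear
combinations, are its coefficients as a polynomial in \<open>s\<close>. The coefficient of \<open>s\<close> is a shift by
\<open>u\<close> at \<open>x\<close> together with a shift by some \<open>- v\<close> at \<open>y\<close> (\<open>tame_trade\<close>): up to basic shifts, the shift at
\<open>x\<close> has been traded for a shift at \<open>y\<close>.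

Now cut the generators into consecutive finite blocks. The shifts wanted in block \<open>b\<close>, plus what was
carried into it from block \<open>b - 1\<close>, are traded for a single shift at the last generator of
block \<open>b + 1\<close>. These trades telescope to \<open>(d\<^sub>i)\<close> (\<open>tame_decomposition\<close>), and each involves two adjacent
blocks only. The trades with even \<open>b\<close> therefore move disjoint sets of generators, and so do those
with odd \<open>b\<close>; each of the two classes is realised by an infinite composition
whose finite parts are eventually constant on every element (\<open>glue_tame_families\<close>).\<close>

section \<open>The free Lie algebra as a vector space with a bracket\<close>

instantiation free_lie :: (field, type) ab_group_add
begin

definition plus_free_lie :: "('a, 'b) free_lie \<Rightarrow> ('a, 'b) free_lie \<Rightarrow> ('a, 'b) free_lie"
  where "plus_free_lie = free_add"
definition zero_free_lie :: "('a, 'b) free_lie"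
  where "zero_free_lie = free_zero"
definition uminus_free_lie :: "('a, 'b) free_lie \<Rightarrow> ('a, 'b) free_lie"
  where "uminus_free_lie = free_scale (-1)"
definition minus_free_lie :: "('a, 'b) free_lie \<Rightarrow> ('a, 'b) free_lie \<Rightarrow> ('a, 'b) free_lie"
  where "minus_free_lie x y = free_add x (free_scale (-1) y)"

instance
proof
  fix a b c :: "('a, 'b) free_lie"
  show "a + b + c = a + (b + c)"
    unfolding plus_free_lie_def by transfer (rule lie_eq.add_assoc)
  show "a + b = b + a"
    unfolding plus_free_lie_def by transfer (rule lie_eq.add_comm)
  show "0 + a = a"
    unfolding plus_free_lie_def zero_free_lie_def by transfer (rule lie_eq.add_zero)
  show "- a + a = 0"
    unfolding plus_free_lie_def zero_free_lie_def uminus_free_lie_def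
    by transfer (rule lie_eq.add_inverse)
  show "a - b = a + - b"
    unfolding plus_free_lie_def minus_free_lie_def uminus_free_lie_def ..
qed

end

interpretation free_lie: vector_space "free_scale :: 'k::field \<Rightarrow> ('k, 'x) free_lie \<Rightarrow> ('k, 'x) free_lie"
proof
  fix a b :: 'k and x y :: "('k, 'x) free_lie"
  show "free_scale a (x + y) = free_scale a x + free_scale a y"
    unfolding plus_free_lie_def by transfer (rule lie_eq.scale_add_right)
  show "free_scale (a + b) x = free_scale a x + free_scale b x"
    unfolding plus_free_lie_def by transfer (rule lie_eq.scale_add_left)
  show "free_scale a (free_scale b x) = free_scale (a * b) x"
    by transfer (rule lie_eq.scale_scale)
  show "free_scale 1 x = x"
    by transfer (rule lie_eq.scale_one)
qed

lemma free_lie_algebra_simps [simp]: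
  "carrier (free_lie_algebra :: ('k::field, ('k, 'x) free_lie) lie_structure) = UNIV"
  "lie_add (free_lie_algebra :: ('k, ('k, 'x) free_lie) lie_structure) = (+)"
  "lie_zero (free_lie_algebra :: ('k, ('k, 'x) free_lie) lie_structure) = 0"
  "lie_scale (free_lie_algebra :: ('k, ('k, 'x) free_lie) lie_structure) = free_scale"
  "lie_bracket (free_lie_algebra :: ('k, ('k, 'x) free_lie) lie_structure) = free_bracket"
  by (simp_all add: free_lie_algebra_def plus_free_lie_def zero_free_lie_def)

lemma free_bracket_add_left: "free_bracket (x + y) z = free_bracket x z + free_bracket y z"
  unfolding plus_free_lie_def by transfer (rule lie_eq.bracket_add_left)

lemma free_bracket_add_right: "free_bracket x (y + z) = free_bracket x y + free_bracket x z"
  unfolding plus_free_lie_def by transfer (rule lie_eq.bracket_add_right)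

lemma free_bracket_scale_left: "free_bracket (free_scale a x) y = free_scale a (free_bracket x y)"
  by transfer (rule lie_eq.bracket_scale_left)

lemma free_bracket_scale_right: "free_bracket x (free_scale a y) = free_scale a (free_bracket x y)"
  by transfer (rule lie_eq.bracket_scale_right)

lemma free_bracket_zero_left: "free_bracket 0 x = 0"
  using free_bracket_add_left[of 0 0 x] by simp

lemma free_bracket_zero_right: "free_bracket x 0 = 0"
  using free_bracket_add_right[of x 0 0] by simp

lemma free_bracket_minus_left: "free_bracket (- x) y = - free_bracket x y"
  using free_bracket_add_left[of "- x" x y]
  by (simp add: free_bracket_zero_left eq_neg_iff_add_eq_0)

lemma free_bracket_minus_right: "free_bracket x (- y) = - free_bracket x y"
  using free_bracket_add_right[of x "- y" y]
  by (simp add: free_bracket_zero_right eq_neg_iff_add_eq_0)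

lemma free_bracket_diff_left: "free_bracket (x - y) z = free_bracket x z - free_bracket y z"
  using free_bracket_add_left[of x "- y" z] by (simp add: free_bracket_minus_left)

lemma free_bracket_diff_right: "free_bracket x (y - z) = free_bracket x y - free_bracket x z"
  using free_bracket_add_right[of x y "- z"] by (simp add: free_bracket_minus_right)

lemma free_bracket_self: "free_bracket x x = 0"
  unfolding zero_free_lie_def by transfer (rule lie_eq.bracket_self)

lemma free_bracket_swap: "free_bracket y x = - free_bracket x y"
proof -
  have "free_bracket y x + free_bracket x y = free_bracket (x + y) (x + y)"
    unfolding free_bracket_add_left free_bracket_add_right by (simp add: free_bracket_self)
  then show ?thesis
    by (simp add: free_bracket_self eq_neg_iff_add_eq_0)
qed

lemma free_bracket_jacobi:
  "free_bracket x (free_bracket y z) + free_bracket y (free_bracket z x) +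
    free_bracket z (free_bracket x y) = 0"
  unfolding zero_free_lie_def plus_free_lie_def by transfer (rule lie_eq.jacobi)

lemma free_bracket_leibniz:
  "free_bracket x (free_bracket y z) =
    free_bracket (free_bracket x y) z - free_bracket (free_bracket x z) y"
  using free_bracket_jacobi[of x y z]
    free_bracket_swap[of z "free_bracket x y"] free_bracket_swap[of y "free_bracket z x"]
    free_bracket_swap[of x z]
  by (simp add: free_bracket_minus_left free_bracket_minus_right algebra_simps)

lemma free_lie_induct [case_names Gen Zero Add Scale Bracket, induct type: free_lie]:
  fixes P :: "('k::field, 'x) free_lie \<Rightarrow> bool"
  assumes gen: "\<And>i. P (free_gen i)" and zero: "P 0"
    and add: "\<And>x y. P x \<Longrightarrow> P y \<Longrightarrow> P (x + y)"
    and scale: "\<And>a x. P x \<Longrightarrow> P (free_scale a x)"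
    and bracket: "\<And>x y. P x \<Longrightarrow> P y \<Longrightarrow> P (free_bracket x y)"
  shows "P x"
proof (induction x rule: free_lie.abs_induct)
  fix t :: "('k, 'x) lie_term"
  show "P (abs_free_lie t)"
    by (induction t)
      (use assms in \<open>auto simp: zero_free_lie_def plus_free_lie_def
        simp flip: free_gen.abs_eq free_zero.abs_eq free_add.abs_eq free_scale.abs_eq
          free_bracket.abs_eq\<close>)
qed

section \<open>Endomorphisms\<close>

abbreviation lie_endo :: "(('k::field, 'x) free_lie \<Rightarrow> ('k, 'x) free_lie) \<Rightarrow> bool" where
  "lie_endo h \<equiv> h \<in> lie_hom free_lie_algebra free_lie_algebra"

lemma lie_endoI:
  assumes "\<And>x y. h (x + y) = h x + h y" "\<And>a x. h (free_scale a x) = free_scale a (h x)"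
    "\<And>x y. h (free_bracket x y) = free_bracket (h x) (h y)"
  shows "lie_endo h"
  using assms by (simp add: lie_hom_def)

context
  fixes h :: "('k::field, 'x) free_lie \<Rightarrow> ('k, 'x) free_lie"
  assumes h: "lie_endo h"
begin

lemma lie_endo_add: "h (x + y) = h x + h y"
  and lie_endo_scale: "h (free_scale a x) = free_scale a (h x)"
  and lie_endo_bracket: "h (free_bracket x y) = free_bracket (h x) (h y)"
  using h by (simp_all add: lie_hom_def)

lemma lie_endo_zero: "h 0 = 0"
  using lie_endo_scale[of 0 0] by simp

lemma lie_endo_minus: "h (- x) = - h x"
  using lie_endo_add[of "- x" x] by (simp add: lie_endo_zero eq_neg_iff_add_eq_0)

lemma lie_endo_diff: "h (x - y) = h x - h y"
  using lie_endo_add[of x "- y"] by (simp add: lie_endo_minus)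

lemmas lie_endo_simps = lie_endo_add lie_endo_scale lie_endo_bracket lie_endo_zero
  lie_endo_minus lie_endo_diff

end

lemma lie_endo_id: "lie_endo (\<lambda>x. x)"
  by (rule lie_endoI) auto

lemma lie_endo_comp: "lie_endo g \<Longrightarrow> lie_endo h \<Longrightarrow> lie_endo (\<lambda>x. g (h x))"
  by (rule lie_endoI) (auto simp: lie_endo_simps)

lemma lie_endo_inverse:
  assumes h: "lie_endo h" and hg: "\<And>x. h (g x) = x" and gh: "\<And>x. g (h x) = x"
  shows "lie_endo g"
proof (rule lie_endoI)
  show "g (x + y) = g x + g y" for x y
    using gh[of "g x + g y"] by (simp add: lie_endo_add[OF h] hg)
  show "g (free_scale a x) = free_scale a (g x)" for a x
    using gh[of "free_scale a (g x)"] by (simp add: lie_endo_scale[OF h] hg)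
  show "g (free_bracket x y) = free_bracket (g x) (g y)" for x y
    using gh[of "free_bracket (g x) (g y)"] by (simp add: lie_endo_bracket[OF h] hg)
qed

definition lie_subst ::
  "('x \<Rightarrow> ('k::field, 'x) free_lie) \<Rightarrow> ('k, 'x) free_lie \<Rightarrow> ('k, 'x) free_lie" where
  "lie_subst f = (THE h. lie_endo h \<and> (\<forall>i. h (free_gen i) = f i))"

lemma
  shows lie_endo_subst: "lie_endo (lie_subst f)"
    and lie_subst_gen: "lie_subst f (free_gen i) = f i"
  using theI'[OF lie_algebra.free_lie_universal[OF lie_algebra_free_lie_algebra, of f]]
  by (simp_all add: lie_subst_def)

lemma lie_endo_eqI:
  assumes "lie_endo g" "lie_endo h" "\<And>i. g (free_gen i) = h (free_gen i)"
  shows "g x = h x"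
  by (induction x) (auto simp: assms lie_endo_simps)

section \<open>The lower central series\<close>

declare lower_central.simps(3) [simp del]

abbreviation lcs :: "nat \<Rightarrow> ('k::field, 'x) free_lie set" where
  "lcs \<equiv> lower_central free_lie_algebra"

lemma lie_subspace_free_lie_algebra:
  "lie_subspace free_lie_algebra V \<longleftrightarrow> free_lie.subspace V"
  by (auto simp: lie_subspace_def free_lie.subspace_def)

lemma lie_ideal_lcs: "lie_ideal free_lie_algebra (lcs n)"
  by (rule lie_algebra.lie_ideal_lower_central[OF lie_algebra_free_lie_algebra])

lemma subspace_lcs: "free_lie.subspace (lcs n :: ('k::field, 'x) free_lie set)"
proof -
  have "lie_ideal free_lie_algebra (lcs n :: ('k, 'x) free_lie set)"
    by (rule lie_ideal_lcs)
  then show ?thesis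
    by (simp add: lie_ideal_def lie_subspace_free_lie_algebra)
qed

lemmas lcs_simps = free_lie.subspace_0[OF subspace_lcs] free_lie.subspace_add[OF subspace_lcs]
  free_lie.subspace_diff[OF subspace_lcs] free_lie.subspace_scale[OF subspace_lcs]
  free_lie.subspace_neg[OF subspace_lcs] free_lie.subspace_sum[OF subspace_lcs]

lemma lcs_ideal:
  assumes "x \<in> lcs n"
  shows "free_bracket x y \<in> lcs n" "free_bracket y x \<in> lcs n"
  using lie_ideal_lcs[of n] assms by (auto simp: lie_ideal_def)

lemma bracket_in_lcs:
  assumes "x \<in> lcs (Suc n)"
  shows "free_bracket x y \<in> lcs (Suc (Suc n))" "free_bracket y x \<in> lcs (Suc (Suc n))"
proof -
  show *: "free_bracket x y \<in> lcs (Suc (Suc n))"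
    using assms by (auto simp: lie_span_def lower_central.simps)
  show "free_bracket y x \<in> lcs (Suc (Suc n))"
    using lcs_simps(5)[OF *] free_bracket_swap[of y x] by simp
qed

text \<open>The linear span in the definition of the series, as an induction rule.\<close>

lemma lcs_Suc_induct [consumes 1, case_names zero add scale bracket]:
  assumes "x \<in> lcs (Suc (Suc n))" and "P 0" and "\<And>x y. P x \<Longrightarrow> P y \<Longrightarrow> P (x + y)"
    and "\<And>a x. P x \<Longrightarrow> P (free_scale a x)"
    and "\<And>x y. x \<in> lcs (Suc n) \<Longrightarrow> P (free_bracket x y)"
  shows "P x"
proof -
  have "lie_subspace free_lie_algebra (Collect P)"
    using assms(2-4) by (auto simp: lie_subspace_def)
  then show ?thesis
    using assms(1,5) by (auto simp: lie_span_def lower_central.simps)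
qed

lemma lcs_antimono:
  assumes "m \<le> n"
  shows "lcs n \<subseteq> (lcs m :: ('k::field, 'x) free_lie set)"
proof -
  have "lcs (Suc n) \<subseteq> (lcs n :: ('k::field, 'x) free_lie set)" for n
  proof (cases n)
    case (Suc k)
    have "x \<in> lcs (Suc k)" if "x \<in> lcs (Suc (Suc k))" for x :: "('k, 'x) free_lie"
      using that by (induction rule: lcs_Suc_induct) (auto simp: lcs_simps lcs_ideal)
    with Suc show ?thesis
      by blast
  qed simp
  then show ?thesis
    using assms by (rule lift_Suc_antimono_le)
qed

text \<open>By the Jacobi identity, bracketing with an element of the derived algebra raises the
  weight by two. This is what makes endomorphisms that are trivial modulo the derived algebra
  trivial on every factor of the series.\<close>

lemma bracket_lcs_2:
  assumes x: "x \<in> lcs (Suc n)" and y: "y \<in> lcs 2"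
  shows "free_bracket x y \<in> lcs (Suc (Suc (Suc n)))"
proof -
  have "y \<in> lcs (Suc (Suc 0))"
    using y by (simp add: numeral_2_eq_2)
  then show ?thesis
  proof (induction rule: lcs_Suc_induct)
    case (bracket a b)
    show ?case
      unfolding free_bracket_leibniz
      by (intro lcs_simps bracket_in_lcs x)
  qed (auto simp: free_bracket_zero_right free_bracket_add_right free_bracket_scale_right
      intro: lcs_simps)
qed

lemma lie_endo_lcs:
  assumes h: "lie_endo h" and "x \<in> lcs n"
  shows "h x \<in> lcs n"
proof (cases n)
  case (Suc m)
  have "h x \<in> lcs (Suc m)" if "x \<in> lcs (Suc m)" for x
    using that
  proof (induction m arbitrary: x)
    case (Suc m)
    show ?case
      using Suc.prems
    proof (induction rule: lcs_Suc_induct)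
      case (bracket x y)
      then show ?case
        unfolding lie_endo_bracket[OF h] by (intro bracket_in_lcs Suc.IH)
    qed (auto simp: lie_endo_simps[OF h] intro: lcs_simps)
  qed simp
  with assms(2) Suc show ?thesis
    by blast
qed simp

lemma lie_endo_congruent_on_gens:
  assumes g: "lie_endo g" and h: "lie_endo h"
    and gen: "\<And>i. g (free_gen i) - h (free_gen i) \<in> lcs n"
  shows "g x - h x \<in> lcs n"
proof (induction x)
  case (Add x y)
  then show ?case
    using lcs_simps(2) by (fastforce simp: lie_endo_add[OF g] lie_endo_add[OF h] algebra_simps)
next
  case (Scale a x)
  then show ?case
    by (simp add: lie_endo_scale[OF g] lie_endo_scale[OF h] lcs_simps
        flip: free_lie.scale_right_diff_distrib)
next
  case (Bracket x y)
  have "g (free_bracket x y) - h (free_bracket x y) =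
      free_bracket (g x - h x) (g y) + free_bracket (h x) (g y - h y)"
    by (simp add: lie_endo_bracket[OF g] lie_endo_bracket[OF h] free_bracket_diff_left
        free_bracket_diff_right)
  then show ?case
    using Bracket by (simp add: lcs_simps lcs_ideal)
qed (simp_all add: gen lie_endo_zero[OF g] lie_endo_zero[OF h] lcs_simps)

text \<open>An endomorphism that is the identity modulo the derived algebra acts trivially on every factor of
the lower central series, since \<open>h[x,y] - [x,y] = [h x - x, h y] + [x, h y - y]\<close> and both terms have
higher weight. This is why shifts of weight at least two add up under composition.\<close>

lemma lie_endo_trivial_on_factors:
  assumes h: "lie_endo h" and gen: "\<And>i. h (free_gen i) - free_gen i \<in> lcs 2"
    and "x \<in> lcs (Suc n)"
  shows "h x - x \<in> lcs (Suc (Suc n))"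
  using assms(3)
proof (induction n arbitrary: x)
  case 0
  show ?case
    using lie_endo_congruent_on_gens[OF h lie_endo_id gen] by (simp add: numeral_2_eq_2)
next
  case (Suc n)
  have h2: "h y - y \<in> lcs 2" for y
    using lie_endo_congruent_on_gens[OF h lie_endo_id gen] by simp
  show ?case
    using Suc.prems
  proof (induction rule: lcs_Suc_induct)
    case (add x y)
    then have "(h x - x) + (h y - y) \<in> lcs (Suc (Suc (Suc n)))"
      by (rule lcs_simps(2))
    then show ?case
      by (simp add: lie_endo_simps[OF h] algebra_simps)
  next
    case (scale a x)
    then have "free_scale a (h x - x) \<in> lcs (Suc (Suc (Suc n)))"
      by (rule lcs_simps(4))
    then show ?case
      by (simp add: lie_endo_simps[OF h] free_lie.scale_right_diff_distrib)
  next
    case (bracket x y)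
    have "h (free_bracket x y) - free_bracket x y =
        free_bracket (h x - x) (h y) + free_bracket x (h y - y)"
      by (simp add: lie_endo_bracket[OF h] free_bracket_diff_left free_bracket_diff_right)
    also have "\<dots> \<in> lcs (Suc (Suc (Suc n)))"
      using Suc.IH[OF bracket] by (intro lcs_simps(2) bracket_in_lcs(1) bracket_lcs_2 bracket h2)
    finally show ?case .
  qed (simp add: lie_endo_zero[OF h] lcs_simps(1))
qed

section \<open>Polynomial maps\<close>

text \<open>A Vandermonde argument without determinants: \<open>p(2 s) - 2\<^sup>n p(s)\<close> has smaller degree than a polynomial
\<open>p\<close> of degree \<open>n\<close>, and its coefficients are nonzero multiples of the lower coefficients of \<open>p\<close>, because
the powers of two are distinct. This is where characteristic zero enters.\<close>

lemma (in vector_space) coeffs_in_subspace: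
  assumes char: "\<And>a n. a < n \<Longrightarrow> (2 :: 'a) ^ a \<noteq> 2 ^ n"
    and W: "subspace W"
    and sums: "\<And>s. (\<Sum>a\<le>n. scale (s ^ a) (v a)) \<in> W"
    and "a \<le> n"
  shows "v a \<in> W"
  using sums \<open>a \<le> n\<close>
proof (induction n arbitrary: v a)
  case 0
  then show ?case
    using "0.prems"(1)[of 1] by simp
next
  case (Suc n)
  have low: "v a \<in> W" if a: "a \<le> n" for a
  proof -
    have "(\<Sum>a\<le>n. scale (s ^ a) (scale (2 ^ a - 2 ^ Suc n) (v a))) \<in> W" for s
    proof -
      have "(\<Sum>a\<le>Suc n. scale ((2 * s) ^ a) (v a)) -
          scale (2 ^ Suc n) (\<Sum>a\<le>Suc n. scale (s ^ a) (v a)) \<in> W"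
        by (intro subspace_diff subspace_scale W Suc.prems(1))
      also have "(\<Sum>a\<le>Suc n. scale ((2 * s) ^ a) (v a)) -
          scale (2 ^ Suc n) (\<Sum>a\<le>Suc n. scale (s ^ a) (v a)) =
          (\<Sum>a\<le>Suc n. scale (s ^ a) (scale (2 ^ a - 2 ^ Suc n) (v a)))"
      proof -
        have "scale ((2 * s) ^ a) (v a) - scale (2 ^ Suc n) (scale (s ^ a) (v a)) =
            scale (s ^ a) (scale (2 ^ a - 2 ^ Suc n) (v a))" for a
          unfolding scale_scale power_mult_distrib scale_left_diff_distrib[symmetric]
            right_diff_distrib by (simp only: mult.commute)
        then show ?thesis
          by (simp only: scale_sum_right sum_subtractf[symmetric])
      qed
      finally show ?thesis
        by simp
    qed
    then have "scale (2 ^ a - 2 ^ Suc n) (v a) \<in> W"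
      using a by (rule Suc.IH)
    then have "scale (inverse (2 ^ a - 2 ^ Suc n)) (scale (2 ^ a - 2 ^ Suc n) (v a)) \<in> W"
      by (rule subspace_scale[OF W])
    then show ?thesis
      using char[of a "Suc n"] a by simp
  qed
  show ?case
  proof (cases "a = Suc n")
    case True
    have "(\<Sum>a\<le>Suc n. scale (1 ^ a) (v a)) - (\<Sum>a\<le>n. v a) \<in> W"
      by (intro subspace_diff subspace_sum W Suc.prems(1) low) simp
    then show ?thesis
      using True by simp
  qed (use low Suc.prems in simp)
qed

definition polynomial_map :: "('k::field \<Rightarrow> ('k, 'x) free_lie) \<Rightarrow> bool" where
  "polynomial_map f \<longleftrightarrow> (\<exists>n v. \<forall>s. f s = (\<Sum>a\<le>n. free_scale (s ^ a) (v a)))"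

lemma polynomial_map_monomial: "polynomial_map (\<lambda>s. free_scale (s ^ k) v)"
  unfolding polynomial_map_def
proof (intro exI allI)
  fix s :: 'a
  show "free_scale (s ^ k) v = (\<Sum>a\<le>k. free_scale (s ^ a) (if a = k then v else 0))"
    by (simp add: if_distrib cong: if_cong)
qed

lemma polynomial_map_add:
  assumes "polynomial_map f" "polynomial_map g"
  shows "polynomial_map (\<lambda>s. f s + g s)"
proof -
  obtain n v where f: "\<And>s. f s = (\<Sum>a\<le>n. free_scale (s ^ a) (v a))"
    using assms(1) by (auto simp: polynomial_map_def)
  obtain m w where g: "\<And>s. g s = (\<Sum>a\<le>m. free_scale (s ^ a) (w a))"
    using assms(2) by (auto simp: polynomial_map_def)
  have pad: "(\<Sum>a\<le>k. free_scale (s ^ a) (if a \<le> j then z a else 0)) =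
      (\<Sum>a\<le>j. free_scale (s ^ a) (z a))" if "j \<le> k" for j k s and z :: "nat \<Rightarrow> ('a, 'b) free_lie"
    using that by (intro sum.mono_neutral_cong_right) auto
  have "f s + g s = (\<Sum>a\<le>max n m. free_scale (s ^ a)
      ((if a \<le> n then v a else 0) + (if a \<le> m then w a else 0)))" for s
    unfolding free_lie.scale_right_distrib sum.distrib f g
    by (simp only: pad max.cobounded1 max.cobounded2)
  then show ?thesis
    unfolding polynomial_map_def by (intro exI allI)
qed

lemma polynomial_map_const: "polynomial_map (\<lambda>_. v)"
  using polynomial_map_monomial[of 0] by simp

lemma polynomial_map_sum:
  "(\<And>a. a \<in> S \<Longrightarrow> polynomial_map (f a)) \<Longrightarrow> polynomial_map (\<lambda>s. \<Sum>a\<in>S. f a s)"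
  by (induction S rule: infinite_finite_induct)
    (auto intro: polynomial_map_add polynomial_map_const)

lemma free_bracket_sum_left: "free_bracket (\<Sum>a\<in>S. f a) x = (\<Sum>a\<in>S. free_bracket (f a) x)"
  by (induction S rule: infinite_finite_induct)
    (auto simp: free_bracket_zero_left free_bracket_add_left)

lemma free_bracket_sum_right: "free_bracket x (\<Sum>a\<in>S. f a) = (\<Sum>a\<in>S. free_bracket x (f a))"
  by (induction S rule: infinite_finite_induct)
    (auto simp: free_bracket_zero_right free_bracket_add_right)

lemma polynomial_map_scale:
  assumes "polynomial_map f"
  shows "polynomial_map (\<lambda>s. free_scale b (f s))"
proof -
  obtain n v where f: "\<And>s. f s = (\<Sum>a\<le>n. free_scale (s ^ a) (v a))"
    using assms by (auto simp: polynomial_map_def)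
  have "free_scale b (f s) = (\<Sum>a\<le>n. free_scale (s ^ a) (free_scale b (v a)))" for s
    unfolding f free_lie.scale_sum_right by (simp add: mult.commute)
  then show ?thesis
    unfolding polynomial_map_def by (intro exI allI)
qed

lemma polynomial_map_bracket:
  assumes "polynomial_map f" "polynomial_map g"
  shows "polynomial_map (\<lambda>s. free_bracket (f s) (g s))"
proof -
  obtain n v where f: "\<And>s. f s = (\<Sum>a\<le>n. free_scale (s ^ a) (v a))"
    using assms(1) by (auto simp: polynomial_map_def)
  obtain m w where g: "\<And>s. g s = (\<Sum>b\<le>m. free_scale (s ^ b) (w b))"
    using assms(2) by (auto simp: polynomial_map_def)
  have "free_bracket (f s) (g s) =
      (\<Sum>b\<le>m. \<Sum>a\<le>n. free_scale (s ^ (b + a)) (free_bracket (v a) (w b)))" for s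
    by (simp add: f g free_bracket_sum_left free_bracket_sum_right free_bracket_scale_left
        free_bracket_scale_right power_add free_lie.scale_sum_right mult.commute)
  then show ?thesis
    by (simp add: polynomial_map_sum polynomial_map_monomial)
qed

text \<open>Substituting polynomially varying elements for the generators gives a polynomial map. It is applied
to the substitutions \<open>x \<mapsto> x + s y\<close>.\<close>

lemma polynomial_map_lie_subst:
  assumes "\<And>i. polynomial_map (\<lambda>s. f s i)"
  shows "polynomial_map (\<lambda>s. lie_subst (f s) x)"
  by (induction x)
    (simp_all add: lie_subst_gen assms lie_endo_simps[OF lie_endo_subst] polynomial_map_const
      polynomial_map_add polynomial_map_scale polynomial_map_bracket)

section \<open>Elements that involve only an initial segment of the generators\<close>

text \<open>The subalgebra generated by the first \<open>n\<close> generators, \<open>below n\<close>, is encoded as the fixed set of the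
retraction that kills all other generators. This gives closure under all operations, and
the fact that an endomorphism is determined on \<open>below n\<close> by its values on the first \<open>n\<close> generators,
without an induction over elements.\<close>

definition retract :: "nat \<Rightarrow> ('k::field, nat) free_lie \<Rightarrow> ('k, nat) free_lie" where
  "retract n = lie_subst (\<lambda>i. if i < n then free_gen i else 0)"

definition below :: "nat \<Rightarrow> ('k::field, nat) free_lie set" where
  "below n = {x. retract n x = x}"

lemma lie_endo_retract: "lie_endo (retract n)"
  unfolding retract_def by (rule lie_endo_subst)

lemma free_gen_in_below: "i < n \<Longrightarrow> free_gen i \<in> below n"
  by (simp add: below_def retract_def lie_subst_gen)

lemma subspace_below: "free_lie.subspace (below n)"
  by (simp add: free_lie.subspace_def below_def lie_endo_simps[OF lie_endo_retract])

lemma free_bracket_in_below: "x \<in> below n \<Longrightarrow> y \<in> below n \<Longrightarrow> free_bracket x y \<in> below n"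
  by (simp add: below_def lie_endo_simps[OF lie_endo_retract])

lemma lie_endo_eq_on_below:
  assumes g: "lie_endo g" and h: "lie_endo h" and gen: "\<And>i. i < n \<Longrightarrow> g (free_gen i) = h (free_gen i)"
    and x: "x \<in> below n"
  shows "g x = h x"
proof -
  have "g (retract n x) = h (retract n x)"
    by (rule lie_endo_eqI[OF lie_endo_comp[OF g lie_endo_retract] lie_endo_comp[OF h lie_endo_retract]])
      (simp add: retract_def lie_subst_gen gen lie_endo_zero[OF g] lie_endo_zero[OF h])
  then show ?thesis
    using x by (simp add: below_def)
qed

lemma lie_endo_below:
  assumes h: "lie_endo h" and gen: "\<And>i. i < n \<Longrightarrow> h (free_gen i) \<in> below m" and x: "x \<in> below n"
  shows "h x \<in> below m"
proof -
  have "retract m (h x) = h x"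
    by (rule lie_endo_eq_on_below[OF lie_endo_comp[OF lie_endo_retract h] h _ x])
      (use gen in \<open>simp add: below_def\<close>)
  then show ?thesis
    by (simp add: below_def)
qed

lemma below_mono: "m \<le> n \<Longrightarrow> x \<in> below m \<Longrightarrow> x \<in> below n"
  by (rule lie_endo_below[OF lie_endo_id free_gen_in_below]) auto

lemma ex_below: "\<exists>n. x \<in> below n"
proof (induction x)
  case (Gen i)
  then show ?case
    using free_gen_in_below[of i "Suc i"] by blast
next
  case Zero
  then show ?case
    using free_lie.subspace_0[OF subspace_below] by blast
next
  case (Add x y)
  then obtain m n where "x \<in> below m" "y \<in> below n"
    by blast
  then have "x \<in> below (max m n)" "y \<in> below (max m n)"
    by (auto intro: below_mono[rotated])
  then show ?case
    using free_lie.subspace_add[OF subspace_below] by blast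
next
  case (Scale a x)
  then show ?case
    using free_lie.subspace_scale[OF subspace_below] by blast
next
  case (Bracket x y)
  then obtain m n where "x \<in> below m" "y \<in> below n"
    by blast
  then have "x \<in> below (max m n)" "y \<in> below (max m n)"
    by (auto intro: below_mono[rotated])
  then show ?case
    using free_bracket_in_below by blast
qed

lemma finite_ex_below:
  assumes "finite S"
  shows "\<exists>n\<ge>k. \<forall>i\<in>S. f i \<in> below n"
  using assms
proof (induction S)
  case (insert j S)
  then obtain n where n: "n \<ge> k" "\<forall>i\<in>S. f i \<in> below n"
    by blast
  obtain m where "f j \<in> below m"
    using ex_below by blast
  with n show ?case
    by (intro exI[of _ "max m n"]) (auto intro: below_mono[rotated] simp: le_max_iff_disj)
qed auto

section \<open>Families of elements and elementary families\<close>

definition family_scale :: "'k \<Rightarrow> ('i \<Rightarrow> ('k::field, 'x) free_lie) \<Rightarrow> 'i \<Rightarrow> ('k, 'x) free_lie" where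
  "family_scale a d = (\<lambda>i. free_scale a (d i))"

interpretation family: vector_space
  "family_scale :: 'k \<Rightarrow> ('i \<Rightarrow> ('k::field, 'x) free_lie) \<Rightarrow> 'i \<Rightarrow> ('k, 'x) free_lie"
  by unfold_locales
    (auto simp: family_scale_def free_lie.scale_right_distrib free_lie.scale_left_distrib)

text \<open>For a linear form \<open>w\<close>, given by its values on the generators, and \<open>u\<close> in the subalgebra
generated by its kernel, the maps \<open>x\<^sub>i \<mapsto> x\<^sub>i + t w\<^sub>i u\<close> fix \<open>u\<close>. Only this consequence is needed, so it takes the
place of a condition on generators of the kernel. The bounds \<open>p\<close> and \<open>q\<close> say that the family moves only
generators with index in \<open>[p, q)\<close> and involves only those with index below \<open>q\<close>.\<close>

definition elementary_families :: "nat \<Rightarrow> nat \<Rightarrow> nat \<Rightarrow> (nat \<Rightarrow> ('k::field, nat) free_lie) set" where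
  "elementary_families c p q = {\<lambda>i. free_scale (w i) u | w u.
     u \<in> lcs c \<and> u \<in> below q \<and> (\<forall>i. i \<notin> {p..<q} \<longrightarrow> w i = 0) \<and>
     (\<forall>t. lie_subst (\<lambda>i. free_gen i + free_scale (t * w i) u) u = u)}"

definition tame_families :: "nat \<Rightarrow> nat \<Rightarrow> nat \<Rightarrow> (nat \<Rightarrow> ('k::field, nat) free_lie) set" where
  "tame_families c p q = family.span (elementary_families c p q)"

lemma elementary_families_scale:
  assumes "d \<in> elementary_families c p q"
  shows "family_scale a d \<in> elementary_families c p q"
proof -
  obtain w u where d: "d = (\<lambda>i. free_scale (w i) u)"
    and u: "u \<in> lcs c" "u \<in> below q" "\<And>i. i \<notin> {p..<q} \<Longrightarrow> w i = 0"
    and fixes_u: "\<And>t. lie_subst (\<lambda>i. free_gen i + free_scale (t * w i) u) u = u"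
    using assms by (auto simp: elementary_families_def)
  have "lie_subst (\<lambda>i. free_gen i + free_scale (t * (a * w i)) u) u = u" for t
    using fixes_u[of "t * a"] by (simp add: mult.assoc)
  moreover have "family_scale a d = (\<lambda>i. free_scale (a * w i) u)"
    by (simp add: d family_scale_def)
  ultimately show ?thesis
    unfolding elementary_families_def using u
    by (intro CollectI exI[of _ "\<lambda>i. a * w i"] exI[of _ u]) auto
qed

section \<open>Realising tame families by automorphisms\<close>

text \<open>Automorphisms that move only the generators with index in \<open>[p, q)\<close> and map the subalgebra
\<open>below q\<close> onto itself. The inverse is part of the condition, as it has to preserve \<open>below q\<close> as well.\<close>

definition block_aut :: "nat \<Rightarrow> nat \<Rightarrow> (('k::field, nat) free_lie \<Rightarrow> ('k, nat) free_lie) \<Rightarrow> bool" where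
  "block_aut p q \<phi> \<longleftrightarrow> lie_endo \<phi> \<and> (\<exists>\<psi>. lie_endo \<psi> \<and> (\<forall>x. \<phi> (\<psi> x) = x) \<and> (\<forall>x. \<psi> (\<phi> x) = x) \<and>
     (\<forall>i. i \<notin> {p..<q} \<longrightarrow> \<phi> (free_gen i) = free_gen i \<and> \<psi> (free_gen i) = free_gen i) \<and>
     (\<forall>i<q. \<phi> (free_gen i) \<in> below q \<and> \<psi> (free_gen i) \<in> below q))"

definition shifts_by :: "nat \<Rightarrow> (nat \<Rightarrow> ('k::field, nat) free_lie) \<Rightarrow>
    (('k, nat) free_lie \<Rightarrow> ('k, nat) free_lie) \<Rightarrow> bool" where
  "shifts_by c d \<phi> \<longleftrightarrow> (\<forall>i. d i \<in> lcs c \<and> \<phi> (free_gen i) - (free_gen i + d i) \<in> lcs (Suc c))"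

lemma block_aut_comp:
  assumes "block_aut p q \<phi>" "block_aut p q \<psi>"
  shows "block_aut p q (\<lambda>x. \<phi> (\<psi> x))"
proof -
  obtain \<phi>' where \<phi>: "lie_endo \<phi>" "lie_endo \<phi>'" "\<And>x. \<phi> (\<phi>' x) = x" "\<And>x. \<phi>' (\<phi> x) = x"
    "\<And>i. i \<notin> {p..<q} \<Longrightarrow> \<phi> (free_gen i) = free_gen i"
    "\<And>i. i \<notin> {p..<q} \<Longrightarrow> \<phi>' (free_gen i) = free_gen i"
    "\<And>i. i < q \<Longrightarrow> \<phi> (free_gen i) \<in> below q" "\<And>i. i < q \<Longrightarrow> \<phi>' (free_gen i) \<in> below q"
    using assms(1) unfolding block_aut_def by blast
  obtain \<psi>' where \<psi>: "lie_endo \<psi>" "lie_endo \<psi>'" "\<And>x. \<psi> (\<psi>' x) = x" "\<And>x. \<psi>' (\<psi> x) = x"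
    "\<And>i. i \<notin> {p..<q} \<Longrightarrow> \<psi> (free_gen i) = free_gen i"
    "\<And>i. i \<notin> {p..<q} \<Longrightarrow> \<psi>' (free_gen i) = free_gen i"
    "\<And>i. i < q \<Longrightarrow> \<psi> (free_gen i) \<in> below q" "\<And>i. i < q \<Longrightarrow> \<psi>' (free_gen i) \<in> below q"
    using assms(2) unfolding block_aut_def by blast
  show ?thesis
    unfolding block_aut_def
    using lie_endo_comp[OF \<phi>(1) \<psi>(1)] lie_endo_comp[OF \<psi>(2) \<phi>(2)]
      lie_endo_below[OF \<phi>(1) \<phi>(7) \<psi>(7)] lie_endo_below[OF \<psi>(2) \<psi>(8) \<phi>(8)]
    by (intro conjI exI[of _ "\<lambda>x. \<psi>' (\<phi>' x)"]) (simp_all add: \<phi>(3-6) \<psi>(3-6))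
qed

lemma block_aut_mono:
  assumes "block_aut p q \<phi>" "p' \<le> p" "q \<le> q'"
  shows "block_aut p' q' \<phi>"
proof -
  obtain \<phi>' where \<phi>: "lie_endo \<phi>" "lie_endo \<phi>'" "\<And>x. \<phi> (\<phi>' x) = x" "\<And>x. \<phi>' (\<phi> x) = x"
    and fixed: "\<And>i. i \<notin> {p..<q} \<Longrightarrow> \<phi> (free_gen i) = free_gen i \<and> \<phi>' (free_gen i) = free_gen i"
    and moved: "\<And>i. i < q \<Longrightarrow> \<phi> (free_gen i) \<in> below q \<and> \<phi>' (free_gen i) \<in> below q"
    using assms(1) unfolding block_aut_def by blast
  have "\<phi> (free_gen i) \<in> below q' \<and> \<phi>' (free_gen i) \<in> below q'" if "i < q'" for i
    using that fixed[of i] moved[of i] free_gen_in_below[OF that] below_mono[OF assms(3)]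
    by (cases "i < q") auto
  then show ?thesis
    unfolding block_aut_def using assms(2,3) \<phi> fixed
    by (intro conjI exI[of _ \<phi>']) auto
qed

lemma shifts_by_comp:
  assumes c: "c \<ge> 2" and endo: "lie_endo \<phi>" "lie_endo \<psi>"
    and "shifts_by c d \<phi>" "shifts_by c e \<psi>"
  shows "shifts_by c (d + e) (\<lambda>x. \<phi> (\<psi> x))"
proof -
  obtain n where n: "c = Suc n" "Suc n \<ge> 2"
    using c by (cases c) auto
  have d: "d i \<in> lcs c" "\<phi> (free_gen i) - (free_gen i + d i) \<in> lcs (Suc c)"
    and e: "e i \<in> lcs c" "\<psi> (free_gen i) - (free_gen i + e i) \<in> lcs (Suc c)" for i
    using assms(4,5) by (auto simp: shifts_by_def)
  have trivial: "\<phi> x - x \<in> lcs (Suc c)" if "x \<in> lcs c" for x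
  proof -
    have "\<phi> (free_gen i) - free_gen i \<in> lcs 2" for i
    proof -
      have "(\<phi> (free_gen i) - (free_gen i + d i)) + d i \<in> lcs c"
        using d[of i] lcs_antimono[of c "Suc c"] by (intro lcs_simps(2)) auto
      then show ?thesis
        using lcs_antimono[OF c] by (auto simp: algebra_simps)
    qed
    then show ?thesis
      using that n lie_endo_trivial_on_factors[OF endo(1)] by blast
  qed
  have "\<phi> (\<psi> (free_gen i)) - (free_gen i + (d i + e i)) \<in> lcs (Suc c)" for i
  proof -
    have "\<phi> (\<psi> (free_gen i) - (free_gen i + e i)) + (\<phi> (e i) - e i) +
        (\<phi> (free_gen i) - (free_gen i + d i)) \<in> lcs (Suc c)"
      using lie_endo_lcs[OF endo(1) e(2)] trivial[OF e(1)] d(2) by (blast intro: lcs_simps(2))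
    then show ?thesis
      by (simp add: lie_endo_simps[OF endo(1)] algebra_simps)
  qed
  then show ?thesis
    using d e by (auto simp: shifts_by_def intro: lcs_simps)
qed

text \<open>The maps \<open>x\<^sub>i \<mapsto> x\<^sub>i + t w\<^sub>i u\<close> fix \<open>u\<close> and thus form a one-parameter group.\<close>

lemma elementary_family_realised:
  assumes "d \<in> elementary_families c p q"
  shows "\<exists>\<phi>. block_aut p q \<phi> \<and> shifts_by c d \<phi>"
proof -
  obtain w u where d: "d = (\<lambda>i. free_scale (w i) u)"
    and u: "u \<in> lcs c" "u \<in> below q" and w: "\<And>i. i \<notin> {p..<q} \<Longrightarrow> w i = 0"
    and fixes_u: "\<And>t. lie_subst (\<lambda>i. free_gen i + free_scale (t * w i) u) u = u"
    using assms by (auto simp: elementary_families_def)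
  define \<epsilon> where "\<epsilon> t = lie_subst (\<lambda>i. free_gen i + free_scale (t * w i) u)" for t
  have \<epsilon>: "lie_endo (\<epsilon> t)" for t
    unfolding \<epsilon>_def by (rule lie_endo_subst)
  have \<epsilon>_gen: "\<epsilon> t (free_gen i) = free_gen i + free_scale (t * w i) u" for t i
    by (simp add: \<epsilon>_def lie_subst_gen)
  have \<epsilon>_u: "\<epsilon> t u = u" for t
    by (simp add: \<epsilon>_def fixes_u)
  have \<epsilon>_comp: "\<epsilon> s (\<epsilon> t x) = x" if "s + t = 0" for s t x
  proof (rule lie_endo_eqI[OF lie_endo_comp[OF \<epsilon> \<epsilon>] lie_endo_id])
    fix i
    have "\<epsilon> s (\<epsilon> t (free_gen i)) = free_gen i + free_scale ((s + t) * w i) u"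
      by (simp add: \<epsilon>_gen lie_endo_simps[OF \<epsilon>] \<epsilon>_u distrib_right free_lie.scale_left_distrib)
    then show "\<epsilon> s (\<epsilon> t (free_gen i)) = free_gen i"
      by (simp add: that)
  qed
  have \<epsilon>_below: "\<epsilon> t (free_gen i) \<in> below q" if "i < q" for t i
    unfolding \<epsilon>_gen using that u(2) free_gen_in_below
    by (intro free_lie.subspace_add free_lie.subspace_scale subspace_below) auto
  have "block_aut p q (\<epsilon> 1)"
    unfolding block_aut_def
    by (intro conjI exI[of _ "\<epsilon> (-1)"] \<epsilon>)
      (auto simp: \<epsilon>_comp \<epsilon>_below, auto simp: \<epsilon>_gen w)
  moreover have "shifts_by c d (\<epsilon> 1)"
    using u(1) by (simp add: shifts_by_def d \<epsilon>_gen lcs_simps)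
  ultimately show ?thesis
    by blast
qed

lemma tame_family_realised:
  assumes c: "c \<ge> 2" and d: "d \<in> tame_families c p q"
  shows "\<exists>\<phi>. block_aut p q \<phi> \<and> shifts_by c d \<phi>"
  using d unfolding tame_families_def
proof (induction rule: family.span_induct_alt)
  case base
  have "block_aut p q (\<lambda>x. x)"
    by (auto simp: block_aut_def lie_endo_id free_gen_in_below intro!: exI[of _ "\<lambda>x. x"])
  moreover have "shifts_by c 0 (\<lambda>x. x)"
    by (simp add: shifts_by_def lcs_simps)
  ultimately show ?case
    by blast
next
  case (step a d e)
  obtain \<phi> where \<phi>: "block_aut p q \<phi>" "shifts_by c (family_scale a d) \<phi>"
    using elementary_family_realised[OF elementary_families_scale[OF step(1)]] by blast
  obtain \<psi> where \<psi>: "block_aut p q \<psi>" "shifts_by c e \<psi>"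
    using step by blast
  have "shifts_by c (family_scale a d + e) (\<lambda>x. \<phi> (\<psi> x))"
    using \<phi> \<psi> by (intro shifts_by_comp[OF c]) (simp_all add: block_aut_def)
  then show ?case
    using block_aut_comp[OF \<phi>(1) \<psi>(1)] by blast
qed

section \<open>Moving a shift to a fresh generator\<close>

lemma subspace_tame_families: "family.subspace (tame_families c p q)"
  by (simp add: tame_families_def family.subspace_span)

text \<open>Up to elementary families, a shift at \<open>x\<close> may be replaced by a shift at a generator \<open>y\<close> that does not
occur in it. With \<open>\<theta>\<^sub>s\<close> sending \<open>x\<close> to \<open>x + s y\<close>, the linear form with value \<open>s\<close> at \<open>x\<close> and \<open>- 1\<close> at \<open>y\<close>
vanishes on \<open>x + s y\<close>, so it forms an elementary family with \<open>\<theta>\<^sub>s(u)\<close>. If \<open>\<theta>\<^sub>s(u)\<close> is \<open>u + s v + \<dots>\<close>, the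
coefficient of \<open>s\<close> in that family is \<open>u\<close> at \<open>x\<close> and \<open>- v\<close> at \<open>y\<close>.\<close>

lemma tame_trade:
  fixes u :: "('k::field_char_0, nat) free_lie"
  assumes u: "u \<in> lcs c" "u \<in> below y" and xy: "p \<le> x" "x < y"
  shows "\<exists>v \<in> lcs c \<inter> below (Suc y).
    (\<lambda>i. (if i = x then u else 0) - (if i = y then v else 0)) \<in> tame_families c p (Suc y)"
proof -
  define \<theta> where "\<theta> s = lie_subst (\<lambda>i. free_gen i + (if i = x then free_scale s (free_gen y) else 0))"
    for s :: 'k
  have \<theta>: "lie_endo (\<theta> s)" for s
    unfolding \<theta>_def by (rule lie_endo_subst)
  have \<theta>_gen: "\<theta> s (free_gen i) = free_gen i + (if i = x then free_scale s (free_gen y) else 0)" for s i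
    by (simp add: \<theta>_def lie_subst_gen)
  have \<theta>_lcs: "\<theta> s u \<in> lcs c" for s
    by (rule lie_endo_lcs[OF \<theta> u(1)])
  have \<theta>_below: "\<theta> s u \<in> below (Suc y)" for s
  proof (rule lie_endo_below[OF \<theta> _ u(2)])
    show "\<theta> s (free_gen i) \<in> below (Suc y)" if "i < y" for i
      unfolding \<theta>_gen using that
      by (auto intro!: free_lie.subspace_add free_lie.subspace_scale subspace_below
          free_gen_in_below)
  qed
  have "polynomial_map (\<lambda>s. \<theta> s u)"
    unfolding \<theta>_def
  proof (rule polynomial_map_lie_subst)
    have "polynomial_map (\<lambda>s. free_scale (s ^ 1) (free_gen y :: ('k, nat) free_lie))"
      by (rule polynomial_map_monomial)
    then show "polynomial_map (\<lambda>s. free_gen i + (if i = x then free_scale s (free_gen y) else 0 :: ('k, nat) free_lie))"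
      for i
      by (cases "i = x") (simp_all add: polynomial_map_add polynomial_map_const)
  qed
  then obtain n v' where v': "\<And>s. \<theta> s u = (\<Sum>a\<le>n. free_scale (s ^ a) (v' a))"
    by (auto simp: polynomial_map_def)
  \<comment> \<open>A vanishing top coefficient makes room for the factor \<open>s\<close> in the value at \<open>x\<close>.\<close>
  define v where "v a = (if a \<le> n then v' a else 0)" for a
  have v: "\<theta> s u = (\<Sum>a\<le>Suc n. free_scale (s ^ a) (v a))" for s
    by (simp add: v' v_def)
  have v_0: "v 0 = u"
  proof -
    have "\<theta> 0 u = u"
      by (rule lie_endo_eqI[OF \<theta> lie_endo_id]) (simp add: \<theta>_gen)
    moreover have "(\<Sum>a\<le>Suc n. free_scale (0 ^ a) (v a)) = v 0"
      by (subst sum.atMost_Suc_shift) simp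
    ultimately show ?thesis
      using v[of 0] by simp
  qed
  have char: "(2 :: 'k) ^ a \<noteq> 2 ^ m" if "a < m" for a m
  proof -
    have "(2 :: nat) ^ a \<noteq> 2 ^ m"
      using that by simp
    then have "of_nat (2 ^ a) \<noteq> (of_nat (2 ^ m) :: 'k)"
      by (simp only: of_nat_eq_iff not_False_eq_True)
    then show ?thesis
      by (simp only: of_nat_power of_nat_numeral not_False_eq_True)
  qed
  \<comment> \<open>The coefficient of \<open>s\<^sup>a\<close> in the family with \<open>s \<theta>\<^sub>s(u)\<close> at \<open>x\<close> and \<open>- \<theta>\<^sub>s(u)\<close> at \<open>y\<close>.\<close>
  define g where "g a = (\<lambda>i. (if i = x then (if a = 0 then 0 else v (a - 1)) else 0) -
      (if i = y then v a else 0))" for a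
  have elementary: "(\<Sum>a\<le>Suc n. family_scale (s ^ a) (g a)) \<in> tame_families c p (Suc y)" for s
  proof -
    define w where "w i = (if i = x then s else 0) - (if i = y then 1 else (0 :: 'k))" for i
    have "lie_subst (\<lambda>i. free_gen i + free_scale (t * w i) (\<theta> s u)) (\<theta> s u) = \<theta> s u" for t
    proof (rule lie_endo_eq_on_below[OF lie_endo_comp[OF lie_endo_subst \<theta>] \<theta> _ u(2)])
      fix i
      assume "i < y"
      then show "lie_subst (\<lambda>i. free_gen i + free_scale (t * w i) (\<theta> s u)) (\<theta> s (free_gen i)) =
          \<theta> s (free_gen i)"
        using xy by (auto simp: \<theta>_gen lie_endo_simps[OF lie_endo_subst] lie_subst_gen w_def
            free_lie.scale_right_distrib free_lie.scale_right_diff_distrib mult.commute)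
    qed
    then have "(\<lambda>i. free_scale (w i) (\<theta> s u)) \<in> elementary_families c p (Suc y)"
      unfolding elementary_families_def using \<theta>_lcs \<theta>_below xy
      by (intro CollectI exI[of _ w] exI[of _ "\<theta> s u"]) (auto simp: w_def)
    moreover have "(\<lambda>i. free_scale (w i) (\<theta> s u)) = (\<Sum>a\<le>Suc n. family_scale (s ^ a) (g a))"
    proof
      fix i
      have shift: "free_scale s (\<theta> s u) =
          (\<Sum>a\<le>Suc n. free_scale (s ^ a) (if a = 0 then 0 else v (a - 1)))"
        by (subst sum.atMost_Suc_shift) (simp add: v' v_def free_lie.scale_sum_right)
      have eval: "(\<Sum>a\<le>Suc n. family_scale (s ^ a) (g a)) i =
          (\<Sum>a\<le>Suc n. free_scale (s ^ a) (g a i))"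
        by (induction n) (simp_all add: family_scale_def)
      consider "i = x" | "i = y" | "i \<noteq> x" "i \<noteq> y"
        by blast
      then show "free_scale (w i) (\<theta> s u) = (\<Sum>a\<le>Suc n. family_scale (s ^ a) (g a)) i"
      proof cases
        case 1
        then have "g a i = (if a = 0 then 0 else v (a - 1))" for a
          using xy by (simp add: g_def)
        with 1 xy show ?thesis
          unfolding eval by (simp only: shift[symmetric]) (simp add: w_def)
      next
        case 2
        then have "g a i = - v a" for a
          using xy by (simp add: g_def)
        with 2 xy show ?thesis
          unfolding eval by (simp only: free_lie.scale_minus_right sum_negf v[symmetric]) (simp add: w_def)
      next
        case 3
        then show ?thesis
          unfolding eval by (simp add: w_def g_def del: sum.atMost_Suc)
      qed
    qed
    ultimately show ?thesis
      unfolding tame_families_def by (metis family.span_base)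
  qed
  have "g 1 \<in> tame_families c p (Suc y)"
    by (rule family.coeffs_in_subspace[OF char subspace_tame_families elementary]) auto
  moreover have "g 1 = (\<lambda>i. (if i = x then u else 0) - (if i = y then v 1 else 0))"
    by (auto simp: g_def v_0)
  moreover have "v 1 \<in> lcs c"
    by (rule free_lie.coeffs_in_subspace[OF char subspace_lcs, where n = "Suc n"])
      (use \<theta>_lcs[unfolded v] in auto)
  moreover have "v 1 \<in> below (Suc y)"
    by (rule free_lie.coeffs_in_subspace[OF char subspace_below, where n = "Suc n"])
      (use \<theta>_below[unfolded v] in auto)
  ultimately show ?thesis
    by auto
qed

text \<open>Several shifts can be traded for a single one at a common fresh generator.\<close>

lemma tame_trade_finite:
  fixes f :: "nat \<Rightarrow> ('k::field_char_0, nat) free_lie"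
  assumes "finite S" "S \<subseteq> {p..<y}" "\<And>i. i \<in> S \<Longrightarrow> f i \<in> lcs c \<inter> below y"
  shows "\<exists>v \<in> lcs c \<inter> below (Suc y).
    (\<lambda>i. (if i \<in> S then f i else 0) - (if i = y then v else 0)) \<in> tame_families c p (Suc y)"
  using assms
proof (induction S)
  case empty
  show ?case
    using family.subspace_0[OF subspace_tame_families[of c p "Suc y"]]
    by (intro bexI[of _ 0])
      (auto simp: lcs_simps free_lie.subspace_0[OF subspace_below] zero_fun_def)
next
  case (insert x S)
  obtain v where v: "v \<in> lcs c" "v \<in> below (Suc y)"
    "(\<lambda>i. (if i \<in> S then f i else 0) - (if i = y then v else 0)) \<in> tame_families c p (Suc y)"
    using insert by auto
  obtain w where w: "w \<in> lcs c" "w \<in> below (Suc y)"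
    "(\<lambda>i. (if i = x then f x else 0) - (if i = y then w else 0)) \<in> tame_families c p (Suc y)"
    using tame_trade[of "f x" c y p x] insert.prems by auto
  have "(\<lambda>i. (if i \<in> insert x S then f i else 0) - (if i = y then w + v else 0)) =
      (\<lambda>i. (if i = x then f x else 0) - (if i = y then w else 0)) +
      (\<lambda>i. (if i \<in> S then f i else 0) - (if i = y then v else 0))"
    using insert.hyps by (auto simp: fun_eq_iff)
  then have "(\<lambda>i. (if i \<in> insert x S then f i else 0) - (if i = y then w + v else 0))
      \<in> tame_families c p (Suc y)"
    using family.subspace_add[OF subspace_tame_families w(3) v(3)] by simp
  then show ?case
    using v w by (intro bexI[of _ "w + v"])
      (auto intro: lcs_simps free_lie.subspace_add[OF subspace_below])
qed

section \<open>Every family is a locally finite sum of tame families\<close>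

text \<open>The blocks \<open>[N k, N (k + 1))\<close> and the carries are chosen together, because the end of block \<open>k + 1\<close> must lie
beyond every generator that occurs in the shifts of block \<open>k\<close>, including the one carried
into it. The \<open>k\<close>-th tame family undoes the carry that the previous one left at the last generator of
block \<open>k\<close> and leaves a new one at the last generator of block \<open>k + 1\<close>, so the sum telescopes.\<close>

lemma tame_decomposition:
  fixes d :: "nat \<Rightarrow> ('k::field_char_0, nat) free_lie"
  assumes d: "\<And>i. d i \<in> lcs c"
  shows "\<exists>N F. strict_mono N \<and> (\<forall>k. F k \<in> tame_families c (N k) (N (Suc (Suc k)))) \<and>
    (\<forall>i n. i \<le> n \<longrightarrow> (\<Sum>k\<le>n. F k i) = d i)"
proof -
  \<comment> \<open>A state \<open>(p, q, C)\<close> consists of a block \<open>[p, q)\<close> and the shift \<open>C\<close> carried to its last generator.\<close>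
  define F :: "nat \<times> nat \<times> ('k, nat) free_lie \<Rightarrow> nat \<times> nat \<times> ('k, nat) free_lie \<Rightarrow>
      nat \<Rightarrow> ('k, nat) free_lie"
    where "F = (\<lambda>(p, q, C) (p', q', C') i.
      (if i \<in> {p..<q} then d i + (if i = q - 1 then C else 0) else 0) -
      (if i = q' - 1 then C' else 0))"
  define ok :: "nat \<Rightarrow> nat \<times> nat \<times> ('k, nat) free_lie \<Rightarrow> bool"
    where "ok n = (\<lambda>(p, q, C). p < q \<and> C \<in> lcs c \<and> (n = 0 \<longrightarrow> p = 0 \<and> C = 0))" for n
  define next_ok :: "nat \<times> nat \<times> ('k, nat) free_lie \<Rightarrow> nat \<times> nat \<times> ('k, nat) free_lie \<Rightarrow> bool"
    where "next_ok = (\<lambda>(p, q, C) (p', q', C'). p' = q \<and>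
      F (p, q, C) (p', q', C') \<in> tame_families c p q')"
  have step: "\<exists>t. ok (Suc n) t \<and> next_ok s t" if s: "ok n s" for n s
  proof -
    obtain p q C where s_eq: "s = (p, q, C)"
      by (cases s)
    have pq: "p < q" and C: "C \<in> lcs c"
      using s by (auto simp: ok_def s_eq)
    define f where "f i = d i + (if i = q - 1 then C else 0)" for i
    obtain y where y: "y \<ge> q" "\<forall>i\<in>{p..<q}. f i \<in> below y"
      using finite_ex_below[of "{p..<q}" q f] by auto
    have "f i \<in> lcs c" for i
      using d C by (simp add: f_def lcs_simps)
    then obtain v where v: "v \<in> lcs c"
      "(\<lambda>i. (if i \<in> {p..<q} then f i else 0) - (if i = y then v else 0)) \<in> tame_families c p (Suc y)"
      using tame_trade_finite[of "{p..<q}" p y f c] y by auto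
    have "ok (Suc n) (q, Suc y, v) \<and> next_ok s (q, Suc y, v)"
      using y(1) v unfolding f_def by (simp add: ok_def next_ok_def s_eq F_def)
    then show ?thesis
      by blast
  qed
  have "\<exists>s. ok 0 s"
    by (rule exI[of _ "(0, 1, 0)"]) (simp add: ok_def lcs_simps)
  then obtain S where ok: "\<And>n. ok n (S n)" and next_ok: "\<And>n. next_ok (S n) (S (Suc n))"
    using dependent_nat_choice[of ok "\<lambda>_. next_ok"] step by metis
  define N where "N n = fst (S n)" for n
  define C where "C n = snd (snd (S n))" for n
  have S: "S n = (N n, N (Suc n), C n)" for n
    using next_ok[of n] by (auto simp: N_def C_def next_ok_def split: prod.splits)
  have mono: "strict_mono N"
    using ok by (simp add: strict_mono_Suc_iff ok_def S)
  have tame: "F (S k) (S (Suc k)) \<in> tame_families c (N k) (N (Suc (Suc k)))" for k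
    using next_ok[of k] by (simp add: next_ok_def S)
  have partial_sum: "(\<Sum>k\<le>n. F (S k) (S (Suc k)) i) =
      (if i < N (Suc n) then d i else 0) - (if i = N (Suc (Suc n)) - 1 then C (Suc n) else 0)" for n i
  proof (induction n)
    case 0
    then show ?case
      using ok[of 0] by (simp add: F_def S ok_def)
  next
    case (Suc n)
    have "N (Suc n) < N (Suc (Suc n))"
      using mono by (simp add: strict_mono_Suc_iff)
    then show ?case
      using Suc by (auto simp: F_def S)
  qed
  have "(\<Sum>k\<le>n. F (S k) (S (Suc k)) i) = d i" if "i \<le> n" for i n
  proof -
    have "n < N (Suc n)" "N (Suc n) < N (Suc (Suc n))"
      using strict_mono_imp_increasing[OF mono, of "Suc n"] mono
      by (simp_all add: strict_mono_Suc_iff)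
    then show ?thesis
      unfolding partial_sum using that by auto
  qed
  then show ?thesis
    using mono tame by (intro exI[of _ N] exI[of _ "\<lambda>k. F (S k) (S (Suc k))"]) simp
qed

section \<open>Gluing the block automorphisms\<close>

primrec partial_composition :: "(nat \<Rightarrow> 'a \<Rightarrow> 'a) \<Rightarrow> nat \<Rightarrow> 'a \<Rightarrow> 'a" where
  "partial_composition \<phi> 0 = \<phi> 0"
| "partial_composition \<phi> (Suc k) = (\<lambda>x. partial_composition \<phi> k (\<phi> (Suc k) x))"

lemma block_aut_endo: "block_aut p q \<phi> \<Longrightarrow> lie_endo \<phi>"
  by (simp add: block_aut_def)

lemma block_aut_inj: "block_aut p q \<phi> \<Longrightarrow> inj \<phi>"
  unfolding block_aut_def by (metis injI)

lemma block_aut_surj_below: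
  assumes "block_aut p q \<phi>" "y \<in> below q"
  obtains x where "x \<in> below q" "\<phi> x = y"
proof -
  obtain \<psi> where \<psi>: "lie_endo \<psi>" "\<And>x. \<phi> (\<psi> x) = x" "\<And>i. i < q \<Longrightarrow> \<psi> (free_gen i) \<in> below q"
    using assms(1) unfolding block_aut_def by blast
  show thesis
    using that[of "\<psi> y"] lie_endo_below[OF \<psi>(1,3) assms(2)] \<psi>(2) by blast
qed

lemma block_aut_fixes_below:
  assumes \<phi>: "block_aut p q \<phi>" and x: "x \<in> below p"
  shows "\<phi> x = x"
  by (rule lie_endo_eq_on_below[OF block_aut_endo[OF \<phi>] lie_endo_id _ x])
    (use \<phi> in \<open>auto simp: block_aut_def\<close>)

text \<open>Let \<open>\<phi>\<^sub>k\<close> realise \<open>F k\<close> within its block. On elements below \<open>P (k + 1)\<close> the infinite composition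
\<open>\<phi>\<^sub>0 \<phi>\<^sub>1 \<phi>\<^sub>2 \<dots>\<close> equals \<open>\<phi>\<^sub>0 \<dots> \<phi>\<^sub>k\<close>, because the later factors fix them. So it is defined everywhere,
and it is bijective because each finite composition permutes these elements. The
sum up to \<open>i\<close> in the conclusion is the full sum at the generator \<open>i\<close>, since \<open>i < P k\<close> for \<open>k > i\<close>.\<close>

lemma glue_tame_families:
  fixes F :: "nat \<Rightarrow> nat \<Rightarrow> ('k::field, nat) free_lie"
  assumes c: "c \<ge> 2" and P: "strict_mono P"
    and F: "\<And>k. F k \<in> tame_families c (P k) (P (Suc k))"
  shows "\<exists>\<psi>. lie_endo \<psi> \<and> bij \<psi> \<and> shifts_by c (\<lambda>i. \<Sum>k\<le>i. F k i) \<psi>"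
proof -
  obtain \<phi> where \<phi>: "\<And>k. block_aut (P k) (P (Suc k)) (\<phi> k)" "\<And>k. shifts_by c (F k) (\<phi> k)"
    using tame_family_realised[OF c F] by metis
  define \<psi> where "\<psi> = partial_composition \<phi>"
  have P_less: "k < P (Suc k)" and P_mono: "j \<le> k \<Longrightarrow> P j \<le> P k" for j k
    using strict_mono_imp_increasing[OF P, of "Suc k"] P by (simp_all add: strict_mono_less_eq)
  have aut: "block_aut 0 (P (Suc k)) (\<psi> k)" for k
  proof (induction k)
    case 0
    show ?case
      using block_aut_mono[OF \<phi>(1)[of 0]] by (simp add: \<psi>_def)
  next
    case (Suc k)
    have "block_aut 0 (P (Suc (Suc k))) (\<psi> k)"
      using block_aut_mono[OF Suc] P_mono by simp
    moreover have "block_aut 0 (P (Suc (Suc k))) (\<phi> (Suc k))"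
      using block_aut_mono[OF \<phi>(1)] by simp
    ultimately show ?case
      using block_aut_comp by (simp add: \<psi>_def)
  qed
  note endo = block_aut_endo[OF aut]
  have shift: "shifts_by c (\<Sum>m\<le>k. F m) (\<psi> k)" for k
  proof (induction k)
    case (Suc k)
    show ?case
      using shifts_by_comp[OF c endo block_aut_endo[OF \<phi>(1)] Suc \<phi>(2)[of "Suc k"]]
      by (simp only: \<psi>_def partial_composition.simps sum.atMost_Suc)
  qed (simp add: \<psi>_def \<phi>)
  have stable: "\<psi> (k + m) x = \<psi> k x" if x: "x \<in> below (P (Suc k))" for k m x
  proof (induction m)
    case (Suc m)
    have "x \<in> below (P (Suc (k + m)))"
      using below_mono[OF P_mono x] by simp
    then show ?case
      using Suc block_aut_fixes_below[OF \<phi>(1)[of "Suc (k + m)"]] by (simp add: \<psi>_def)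
  qed simp
  \<comment> \<open>The generator \<open>i\<close> lies below \<open>P (i + 1)\<close>, where the compositions are constant from \<open>i\<close> on.\<close>
  define \<Psi> where "\<Psi> = lie_subst (\<lambda>i. \<psi> i (free_gen i))"
  have \<Psi>_endo: "lie_endo \<Psi>" and \<Psi>_gen: "\<Psi> (free_gen i) = \<psi> i (free_gen i)" for i
    by (simp_all add: \<Psi>_def lie_endo_subst lie_subst_gen)
  have \<Psi>_eq: "\<Psi> x = \<psi> k x" if x: "x \<in> below (P (Suc k))" for k x
  proof (rule lie_endo_eq_on_below[OF \<Psi>_endo endo _ x])
    fix i
    assume "i < P (Suc k)"
    then have "\<psi> (k + i) (free_gen i) = \<psi> k (free_gen i)"
      by (intro stable free_gen_in_below)
    moreover have "\<psi> (i + k) (free_gen i) = \<psi> i (free_gen i)"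
      by (intro stable free_gen_in_below P_less)
    ultimately show "\<Psi> (free_gen i) = \<psi> k (free_gen i)"
      by (simp add: \<Psi>_gen add.commute)
  qed
  have exhaust: "\<exists>k\<ge>m. x \<in> below (P (Suc k))" for x m
  proof -
    obtain n where "x \<in> below n"
      using ex_below by blast
    moreover have "n \<le> P (Suc (m + n))"
      using P_less[of "m + n"] by linarith
    ultimately show ?thesis
      using below_mono le_add1 by blast
  qed
  have "inj \<Psi>"
  proof (rule injI)
    fix x y
    assume eq: "\<Psi> x = \<Psi> y"
    obtain j where j: "x \<in> below (P (Suc j))"
      using exhaust by blast
    obtain k where k: "k \<ge> j" "y \<in> below (P (Suc k))"
      using exhaust by blast
    have "x \<in> below (P (Suc k))"
      using below_mono[OF P_mono j] k(1) by simp
    then have "\<psi> k x = \<psi> k y"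
      using eq \<Psi>_eq k(2) by simp
    then show "x = y"
      using block_aut_inj[OF aut] by (simp add: inj_eq)
  qed
  moreover have "surj \<Psi>"
    unfolding surj_def
  proof
    fix y :: "('k, nat) free_lie"
    obtain k where "y \<in> below (P (Suc k))"
      using exhaust by blast
    then obtain x where "x \<in> below (P (Suc k))" "\<psi> k x = y"
      using block_aut_surj_below[OF aut] by blast
    then show "\<exists>x. y = \<Psi> x"
      using \<Psi>_eq by metis
  qed
  moreover have "shifts_by c (\<lambda>i. \<Sum>k\<le>i. F k i) \<Psi>"
  proof -
    have eval: "(\<Sum>m\<le>k. F m) i = (\<Sum>m\<le>k. F m i)" for k i
      by (induction k) auto
    show ?thesis
      using shift unfolding shifts_by_def \<Psi>_gen eval by blast
  qed
  ultimately show ?thesis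
    using \<Psi>_endo by (auto simp: bij_def)
qed

text \<open>The tame families of a decomposition overlap only if they are adjacent, so those with even index can be
glued, and likewise those with odd index.\<close>

lemma every_shift_realised:
  fixes d :: "nat \<Rightarrow> ('k::field_char_0, nat) free_lie"
  assumes c: "c \<ge> 2" and d: "\<And>i. d i \<in> lcs c"
  shows "\<exists>\<psi>. lie_endo \<psi> \<and> bij \<psi> \<and> shifts_by c d \<psi>"
proof -
  obtain N F where N: "strict_mono N"
    and F: "\<And>k. F k \<in> tame_families c (N k) (N (Suc (Suc k)))"
    and sum: "\<And>i n. i \<le> n \<Longrightarrow> (\<Sum>k\<le>n. F k i) = d i"
    using tame_decomposition[of d c, OF d] by blast
  have mono: "strict_mono (\<lambda>k. N (2 * k))" "strict_mono (\<lambda>k. N (Suc (2 * k)))"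
    by (auto intro!: strict_monoI strict_monoD[OF N])
  obtain \<phi> where \<phi>: "lie_endo \<phi>" "bij \<phi>" "shifts_by c (\<lambda>i. \<Sum>k\<le>i. F (2 * k) i) \<phi>"
    using glue_tame_families[OF c mono(1), of "\<lambda>k. F (2 * k)"] F by auto
  obtain \<psi> where \<psi>: "lie_endo \<psi>" "bij \<psi>" "shifts_by c (\<lambda>i. \<Sum>k\<le>i. F (Suc (2 * k)) i) \<psi>"
    using glue_tame_families[OF c mono(2), of "\<lambda>k. F (Suc (2 * k))"] F by auto
  have "(\<Sum>k\<le>n. F (2 * k) i) + (\<Sum>k\<le>n. F (Suc (2 * k)) i) = (\<Sum>k\<le>Suc (2 * n). F k i)" for n i
    by (induction n) (simp_all add: algebra_simps)
  then have "(\<lambda>i. \<Sum>k\<le>i. F (2 * k) i) + (\<lambda>i. \<Sum>k\<le>i. F (Suc (2 * k)) i) = d"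
    by (simp add: fun_eq_iff sum del: sum.atMost_Suc)
  then have "shifts_by c d (\<lambda>x. \<phi> (\<psi> x))"
    using shifts_by_comp[OF c \<phi>(1) \<psi>(1) \<phi>(3) \<psi>(3)] by simp
  moreover have "bij (\<lambda>x. \<phi> (\<psi> x))"
    using bij_comp[OF \<psi>(2) \<phi>(2)] by (simp add: comp_def)
  ultimately show ?thesis
    using lie_endo_comp[OF \<phi>(1) \<psi>(1)] by blast
qed

section \<open>Lifting automorphisms\<close>

text \<open>The free Lie algebra with its bracket replaced by zero. By freeness, the generators extend to a
homomorphism into it, which is the projection of the free Lie algebra onto its linear part.\<close>

definition abelianised :: "('k::field, ('k, 'x) free_lie) lie_structure" where
  "abelianised = free_lie_algebra\<lparr>lie_bracket := \<lambda>_ _. 0\<rparr>"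

lemma lie_algebra_abelianised: "lie_algebra (abelianised :: ('k::field, ('k, 'x) free_lie) lie_structure)"
proof -
  interpret lie_algebra "free_lie_algebra :: ('k, ('k, 'x) free_lie) lie_structure"
    by (rule lie_algebra_free_lie_algebra)
  show ?thesis
    by (intro lie_algebra.intro)
      (use additive_group in \<open>auto simp: abelianised_def free_lie.scale_right_distrib
        free_lie.scale_left_distrib\<close>)
qed

lemma ex_linear_part:
  "\<exists>h :: ('k::field, 'x) free_lie \<Rightarrow> ('k, 'x) free_lie.
    (\<forall>x y. h (x + y) = h x + h y) \<and> (\<forall>a x. h (free_scale a x) = free_scale a (h x)) \<and>
    (\<forall>x y. h (free_bracket x y) = 0) \<and> (\<forall>i. h (free_gen i) = free_gen i)"
  using lie_algebra.free_lie_universal[OF lie_algebra_abelianised,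
      of "free_gen :: 'x \<Rightarrow> ('k, 'x) free_lie"]
  by (auto simp: lie_hom_def abelianised_def)

text \<open>Taking the linear parts of the images of the generators turns endomorphisms that are inverse to each
other modulo the derived algebra into linear substitutions that are inverse to each other exactly.\<close>

lemma lift_mod_derived:
  assumes a: "lie_endo a" and b: "lie_endo b"
    and ab: "\<And>x. a (b x) - x \<in> lcs 2" and ba: "\<And>x. b (a x) - x \<in> lcs 2"
  shows "\<exists>\<phi>. lie_endo \<phi> \<and> bij \<phi> \<and> (\<forall>x. \<phi> x - a x \<in> lcs 2)"
proof -
  obtain h :: "('a, 'b) free_lie \<Rightarrow> ('a, 'b) free_lie" where
    h_add: "\<And>x y. h (x + y) = h x + h y" and h_scale: "\<And>r x. h (free_scale r x) = free_scale r (h x)"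
    and h_bracket: "\<And>x y. h (free_bracket x y) = 0" and h_gen: "\<And>i. h (free_gen i) = free_gen i"
    using ex_linear_part by blast
  have h_zero: "h 0 = 0"
    using h_scale[of 0 0] by simp
  have h_lcs: "h x = 0" if "x \<in> lcs (Suc (Suc 0))" for x
    using that by (induction rule: lcs_Suc_induct) (auto simp: h_zero h_add h_scale h_bracket)
  have h_cong: "h x = h y" if "x - y \<in> lcs 2" for x y
    using h_add[of "x - y" y] h_lcs[of "x - y"] that by (simp add: numeral_2_eq_2)
  have h_residue: "h x - x \<in> lcs 2" for x
  proof (induction x)
    case (Add x y)
    then have "(h x - x) + (h y - y) \<in> lcs 2"
      by (rule lcs_simps(2))
    then show ?case
      by (simp add: h_add algebra_simps)
  next
    case (Scale r x)
    then have "free_scale r (h x - x) \<in> lcs 2"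
      by (rule lcs_simps(4))
    then show ?case
      by (simp add: h_scale free_lie.scale_right_diff_distrib)
  next
    case (Bracket x y)
    have "free_bracket x y \<in> lcs (Suc (Suc 0))"
      by (rule bracket_in_lcs) simp
    then show ?case
      by (simp add: h_bracket lcs_simps(5) numeral_2_eq_2)
  qed (simp_all add: h_gen h_zero lcs_simps(1))
  define lin where "lin g = lie_subst (\<lambda>i. h (g (free_gen i)))" for g :: "('a, 'b) free_lie \<Rightarrow> ('a, 'b) free_lie"
  have lin_endo: "lie_endo (lin g)" and lin_gen: "lin g (free_gen i) = h (g (free_gen i))" for g i
    by (simp_all add: lin_def lie_endo_subst lie_subst_gen)
  \<comment> \<open>Both sides are linear, agree on generators and vanish on brackets.\<close>
  have lin_h: "lin g (h x) = h (g x)" if g: "lie_endo g" for g x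
    by (induction x)
      (simp_all add: h_gen h_zero h_add h_scale h_bracket lin_gen lie_endo_simps[OF lin_endo]
        lie_endo_simps[OF g])
  have inverse: "lin g (lin g' x) = x"
    if g: "lie_endo g" and gg': "\<And>x. g (g' x) - x \<in> lcs 2" for g g' x
    by (rule lie_endo_eqI[OF lie_endo_comp[OF lin_endo lin_endo] lie_endo_id])
      (simp add: lin_gen lin_h[OF g] h_cong[OF gg'] h_gen)
  have "bij (lin a)"
    using inverse[OF a ab] inverse[OF b ba] by (intro o_bij[of "lin b"]) (auto simp: fun_eq_iff)
  moreover have "lin a x - a x \<in> lcs 2" for x
    by (rule lie_endo_congruent_on_gens[OF lin_endo a]) (simp add: lin_gen h_residue)
  ultimately show ?thesis
    using lin_endo by blast
qed

text \<open>If \<open>\<phi>\<close> agrees with \<open>a\<close> modulo one term of the series, then \<open>\<phi>\<inverse> a\<close> shifts the generators by elements of that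
term, and composing \<open>\<phi>\<close> with an automorphism that has the same shifts improves the agreement by one
step.\<close>

lemma lift_mod_lcs:
  fixes a b :: "('k::field_char_0, nat) free_lie \<Rightarrow> ('k, nat) free_lie"
  assumes a: "lie_endo a" and b: "lie_endo b"
    and ab: "\<And>x. a (b x) - x \<in> lcs 2" and ba: "\<And>x. b (a x) - x \<in> lcs 2"
  shows "\<exists>\<phi>. lie_endo \<phi> \<and> bij \<phi> \<and> (\<forall>x. \<phi> x - a x \<in> lcs (Suc (Suc n)))"
proof (induction n)
  case 0
  show ?case
    using lift_mod_derived[OF a b ab ba] by (simp add: numeral_2_eq_2)
next
  case (Suc n)
  let ?c = "Suc (Suc n)"
  obtain \<phi> where \<phi>: "lie_endo \<phi>" "bij \<phi>" "\<And>x. \<phi> x - a x \<in> lcs ?c"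
    using Suc by blast
  define \<phi>' where "\<phi>' = inv_into UNIV \<phi>"
  have \<phi>'_right: "\<phi> (\<phi>' x) = x" and \<phi>'_left: "\<phi>' (\<phi> x) = x" for x
    using \<phi>(2) by (simp_all add: \<phi>'_def bij_is_surj surj_f_inv_f bij_is_inj)
  have \<phi>': "lie_endo \<phi>'"
    by (rule lie_endo_inverse[OF \<phi>(1) \<phi>'_right \<phi>'_left])
  have "\<phi>' (a (free_gen i)) - free_gen i \<in> lcs ?c" for i
  proof -
    have "- \<phi>' (\<phi> (free_gen i) - a (free_gen i)) \<in> lcs ?c"
      by (intro lcs_simps(5) lie_endo_lcs[OF \<phi>'] \<phi>(3))
    then show ?thesis
      by (simp add: lie_endo_simps[OF \<phi>'] \<phi>'_left)
  qed
  then obtain \<psi> where \<psi>: "lie_endo \<psi>" "bij \<psi>" "shifts_by ?c (\<lambda>i. \<phi>' (a (free_gen i)) - free_gen i) \<psi>"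
    using every_shift_realised[of ?c "\<lambda>i. \<phi>' (a (free_gen i)) - free_gen i"] by auto
  have "\<phi> (\<psi> (free_gen i)) - a (free_gen i) \<in> lcs (Suc ?c)" for i
  proof -
    have "\<psi> (free_gen i) - \<phi>' (a (free_gen i)) \<in> lcs (Suc ?c)"
      using \<psi>(3) by (simp add: shifts_by_def)
    then have "\<phi> (\<psi> (free_gen i) - \<phi>' (a (free_gen i))) \<in> lcs (Suc ?c)"
      by (rule lie_endo_lcs[OF \<phi>(1)])
    then show ?thesis
      by (simp add: lie_endo_simps[OF \<phi>(1)] \<phi>'_right)
  qed
  then have "\<phi> (\<psi> x) - a x \<in> lcs (Suc ?c)" for x
    by (rule lie_endo_congruent_on_gens[OF lie_endo_comp[OF \<phi>(1) \<psi>(1)] a])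
  moreover have "bij (\<lambda>x. \<phi> (\<psi> x))"
    using bij_comp[OF \<psi>(2) \<phi>(2)] by (simp add: comp_def)
  ultimately show ?case
    using lie_endo_comp[OF \<phi>(1) \<psi>(1)] by blast
qed

lemma lie_aut_inv_into:
  assumes L: "lie_algebra L" and \<alpha>: "\<alpha> \<in> lie_aut L"
  shows "inv_into (carrier L) \<alpha> \<in> lie_hom L L"
proof -
  interpret lie_algebra L
    by (rule L)
  let ?\<beta> = "inv_into (carrier L) \<alpha>"
  have hom: "\<alpha> \<in> lie_hom L L" and bij: "bij_betw \<alpha> (carrier L) (carrier L)"
    using \<alpha> by (auto simp: lie_aut_def)
  have closed: "?\<beta> x \<in> carrier L" and right: "\<alpha> (?\<beta> x) = x" if "x \<in> carrier L" for x
    using that bij by (auto simp: bij_betw_def inv_into_into f_inv_into_f)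
  have left: "?\<beta> (\<alpha> x) = x" if "x \<in> carrier L" for x
    using that bij by (simp add: bij_betw_inv_into_left)
  have "?\<beta> (lie_add L x y) = lie_add L (?\<beta> x) (?\<beta> y)" if "x \<in> carrier L" "y \<in> carrier L" for x y
    using left[of "lie_add L (?\<beta> x) (?\<beta> y)"] hom that
    by (simp add: lie_hom_def closed right add_closed)
  moreover have "?\<beta> (lie_scale L a x) = lie_scale L a (?\<beta> x)" if "x \<in> carrier L" for a x
    using left[of "lie_scale L a (?\<beta> x)"] hom that
    by (simp add: lie_hom_def closed right scale_closed)
  moreover have "?\<beta> (lie_bracket L x y) = lie_bracket L (?\<beta> x) (?\<beta> y)"
    if "x \<in> carrier L" "y \<in> carrier L" for x y
    using left[of "lie_bracket L (?\<beta> x) (?\<beta> y)"] hom that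
    by (simp add: lie_hom_def closed right bracket_closed)
  ultimately show ?thesis
    using closed by (simp add: lie_hom_def)
qed

text \<open>Homomorphisms out of the free Lie algebra are determined by the generators, so it suffices to choose
representatives of the images of their cosets.\<close>

lemma lift_quotient_hom:
  fixes I :: "('k::field, 'x) free_lie set"
  defines "Q \<equiv> lie_quotient free_lie_algebra I"
  assumes I: "lie_ideal free_lie_algebra I" and \<alpha>: "\<alpha> \<in> lie_hom Q Q"
  shows "\<exists>a. lie_endo a \<and>
    (\<forall>x. lie_coset free_lie_algebra I (a x) = \<alpha> (lie_coset free_lie_algebra I x))"
proof -
  let ?\<pi> = "lie_coset free_lie_algebra I"
  note L = lie_algebra_free_lie_algebra
  have Q: "lie_algebra Q"
    unfolding Q_def by (rule lie_algebra.lie_algebra_quotient[OF L I])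
  have carrier_Q: "carrier Q = range ?\<pi>"
    unfolding Q_def by (simp add: lie_algebra.carrier_quotient[OF L I])
  have \<pi>: "?\<pi> \<in> lie_hom free_lie_algebra Q"
    unfolding Q_def by (rule lie_algebra.lie_hom_coset[OF L I])
  have "\<alpha> (?\<pi> x) \<in> range ?\<pi>" for x
    using \<alpha> carrier_Q by (simp add: lie_hom_def Pi_iff)
  then have "\<forall>i. \<exists>y. ?\<pi> y = \<alpha> (?\<pi> (free_gen i))"
    by (metis rangeE)
  then obtain f where f: "\<And>i. ?\<pi> (f i) = \<alpha> (?\<pi> (free_gen i))"
    by metis
  have "(\<lambda>x. ?\<pi> (lie_subst f x)) \<in> lie_hom free_lie_algebra Q"
    using \<pi> by (auto simp: lie_hom_def lie_endo_simps[OF lie_endo_subst])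
  moreover have "(\<lambda>x. \<alpha> (?\<pi> x)) \<in> lie_hom free_lie_algebra Q"
    using \<pi> \<alpha> by (auto simp: lie_hom_def Pi_iff)
  moreover have "range (\<lambda>i. \<alpha> (?\<pi> (free_gen i))) \<subseteq> carrier Q"
    using \<pi> \<alpha> by (auto simp: lie_hom_def Pi_iff)
  ultimately have "(\<lambda>x. ?\<pi> (lie_subst f x)) = (\<lambda>x. \<alpha> (?\<pi> x))"
    using lie_algebra.free_lie_universal[OF Q, of "\<lambda>i. \<alpha> (?\<pi> (free_gen i))"]
    by (simp add: Ex1_def) (metis (no_types, lifting) f lie_subst_gen)
  then show ?thesis
    using lie_endo_subst by metis
qed

lemma lie_coset_eq_iff:
  assumes I: "lie_ideal free_lie_algebra I"
  shows "lie_coset free_lie_algebra I x = lie_coset free_lie_algebra I y \<longleftrightarrow> x - y \<in> I"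
proof
  assume "lie_coset free_lie_algebra I x = lie_coset free_lie_algebra I y"
  then have "x \<in> lie_coset free_lie_algebra I y"
    using lie_algebra.coset_self[OF lie_algebra_free_lie_algebra I, of x] by simp
  then show "x - y \<in> I"
    by (auto simp: lie_coset_def)
next
  assume "x - y \<in> I"
  then show "lie_coset free_lie_algebra I x = lie_coset free_lie_algebra I y"
    using lie_algebra.coset_absorb[OF lie_algebra_free_lie_algebra I, of y "x - y"] by simp
qed

theorem theorem1:
  fixes c :: nat
    and \<alpha> :: "('k::field_char_0, nat) free_lie set \<Rightarrow> ('k, nat) free_lie set"
  assumes "c \<ge> 1"
    and "\<alpha> \<in> lie_aut (L_inf_nilpotent c)"
  shows "\<exists>\<phi> \<in> lie_aut L_inf. \<forall>x \<in> carrier L_inf. L_inf_proj c (\<phi> x) = \<alpha> (L_inf_proj c x)"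
proof -
  define n where "n = c + 1"
  let ?I = "lcs n :: ('k, nat) free_lie set"
  define Q where "Q = lie_quotient free_lie_algebra ?I"
  let ?\<pi> = "lie_coset free_lie_algebra ?I"
  have \<alpha>: "\<alpha> \<in> lie_aut Q"
    using assms(2) by (simp add: L_inf_nilpotent_def L_inf_def Q_def n_def)
  have Q: "lie_algebra Q"
    unfolding Q_def
    by (rule lie_algebra.lie_algebra_quotient[OF lie_algebra_free_lie_algebra lie_ideal_lcs])
  let ?\<beta> = "inv_into (carrier Q) \<alpha>"
  obtain a where a: "lie_endo a" "\<And>x. ?\<pi> (a x) = \<alpha> (?\<pi> x)"
    using lift_quotient_hom[OF lie_ideal_lcs, of \<alpha> n] \<alpha> by (auto simp: lie_aut_def Q_def)
  obtain b where b: "lie_endo b" "\<And>x. ?\<pi> (b x) = ?\<beta> (?\<pi> x)"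
    using lift_quotient_hom[OF lie_ideal_lcs, of ?\<beta> n] lie_aut_inv_into[OF Q \<alpha>]
    by (auto simp: Q_def)
  have bij: "bij_betw \<alpha> (carrier Q) (carrier Q)"
    using \<alpha> by (simp add: lie_aut_def)
  have in_Q: "?\<pi> x \<in> carrier Q" for x
    by (simp add: Q_def lie_algebra.carrier_quotient[OF lie_algebra_free_lie_algebra lie_ideal_lcs])
  have "?\<pi> (a (b x)) = ?\<pi> x" "?\<pi> (b (a x)) = ?\<pi> x" for x
    using bij in_Q by (simp_all add: a b bij_betw_inv_into_left bij_betw_inv_into_right)
  then have "a (b x) - x \<in> ?I" "b (a x) - x \<in> ?I" for x
    by (simp_all only: lie_coset_eq_iff[OF lie_ideal_lcs])
  moreover have "?I \<subseteq> lcs 2"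
    using assms(1) by (intro lcs_antimono) (simp add: n_def)
  ultimately have ab: "a (b x) - x \<in> lcs 2" and ba: "b (a x) - x \<in> lcs 2" for x
    by blast+
  obtain \<phi> where \<phi>: "lie_endo \<phi>" "bij \<phi>" "\<And>x. \<phi> x - a x \<in> ?I"
    using lift_mod_lcs[OF a(1) b(1) ab ba, of "c - 1"] assms(1) by (auto simp: n_def)
  have "\<phi> \<in> lie_aut L_inf"
    using \<phi>(1,2) by (simp add: lie_aut_def L_inf_def)
  moreover have "L_inf_proj c (\<phi> x) = \<alpha> (L_inf_proj c x)" for x
    using \<phi>(3)[of x] a(2)[of x]
    by (simp add: L_inf_proj_def L_inf_def n_def[symmetric]
        flip: lie_coset_eq_iff[OF lie_ideal_lcs] del: One_nat_def)
  ultimately show ?thesis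
    by blast
qed

end
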